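(* Let $\Lambda_0,\Lambda_1\in\mathcal{LG}^+(n)$ with Maslov index $m(\Lambda_0,\Lambda_1)=0$. Then there exists a geodesic in $\mathcal{LG}^+(n)$ between $\Lambda_0$ and $\Lambda_1$ with negative semi-definite derivative. If, in addition, $\Lambda_0$ and $\Lambda_1$ intersect transversally, the geodesic has negative definite derivative.
   Context: Equip $\mathbb{C}^n$ with the standard structure: $\omega=\sum_j dx_j\wedge dy_j$, $J$ multiplication by $\sqrt{-1}$, $\Omega=dz_1\wedge\dots\wedge dz_n$, and the standard real inner product. $\mathcal{LG}^+(n)$ is the manifold of real $n$-dimensional linear subspaces $\Lambda\subset\mathbb{C}^n$ with $\omega|_\Lambda=0$ such that $\mathrm{Re}\,\Omega|_\Lambda\ne0$; each is oriented so that $\mathrm{Re}\,\Omega|_\Lambda$ is a positive volume form. The phase of $\Lambda$ is $\mathrm{phase}(\Lambda)\in(-\frac\pi2,\frac\pi2)$ with $\Omega|_\Lambda=e^{\sqrt{-1}\,\mathrm{phase}(\Lambda)}\mathrm{vol}_\Lambda$. The tangent space $T_\Lambda\mathcal{LG}^+(n)$ is canonically the space $Q(\Lambda)$ of quadratic forms on $\Lambda$: for a smooth path $(\Lambda_t)$ with linear lifting $\Psi_t:\mathbb{R}^n\to\mathbb{C}^n$ (linear isomorphisms onto $\Lambda_t$, smooth in $t$), $\frac{d}{dt}\Lambda_t$ is the quadratic form $h_t$ on $\Lambda_t$ with $d(h_t\circ\Psi_t)=\Psi_t^*(i_{\frac{d}{dt}\Psi_t}\omega)$. A lifting is horizontal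 if $\Psi_t^*(i_{\frac{d}{dt}\Psi_t}\mathrm{Re}\,\Omega)=0$ for all $t$. A smooth path $(\Lambda_t)_{t\in[0,1]}$ with derivative $h_t=\frac{d}{dt}\Lambda_t$ is a geodesic (for the positive Lagrangian connection) if, for a horizontal lifting $(\Psi_t)$, $h_t\circ\Psi_t$ is independent of $t$. Maslov index: for $\Lambda_0,\Lambda_1\in\mathcal{LG}^+(n)$ there are distinct $\alpha_1,\dots,\alpha_k\in\mathbb{R}/\pi\mathbb{Z}$ and orthogonal decompositions $\Lambda_i=\bigoplus_{j=1}^kV_{i,j}$ with $e^{\alpha_j\sqrt{-1}}V_{0,j}=V_{1,j}$, unique up to order. Repeating each $\alpha_j$ with multiplicity $\dim V_{0,j}$ and taking representatives $\beta_1,\dots,\beta_n\in[0,\pi)$, $m(\Lambda_0,\Lambda_1)=\frac1\pi\big(\sum_{j=1}^n\beta_j+\mathrm{phase}(\Lambda_0)-\mathrm{phase}(\Lambda_1)\big)$. *)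

theory Defs
  imports "HOL-Analysis.Analysis"
begin

text \<open>\<open>\<complex>\<^sup>n\<close> is \<^typ>\<open>complex^'n\<close> with \<open>z\<^sub>j = x\<^sub>j + i y\<^sub>j\<close>. The standard real inner product is the
  library's \<open>\<bullet>\<close> on this type, and \<^const>\<open>subspace\<close>, \<^const>\<open>dim\<close>, \<^const>\<open>span\<close> refer to its
  real vector space structure.\<close>

definition omega :: "complex^'n \<Rightarrow> complex^'n \<Rightarrow> real" where
  "omega u v = (\<Sum>j\<in>UNIV. Re (u $ j) * Im (v $ j) - Im (u $ j) * Re (v $ j))"

text \<open>The form \<open>dz\<^sub>1 \<and> \<dots> \<and> dz\<^sub>n\<close> on a family of \<open>n\<close> vectors, indexed by \<^typ>\<open>'n\<close> like the
  coordinates.\<close>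

definition Omega :: "('n \<Rightarrow> complex^'n) \<Rightarrow> complex" where
  "Omega v = det (\<chi> i j. v j $ i)"

definition LG_plus :: "(complex^'n) set set" where
  "LG_plus = {\<Lambda>. subspace \<Lambda> \<and> dim \<Lambda> = CARD('n)
     \<and> (\<forall>u\<in>\<Lambda>. \<forall>v\<in>\<Lambda>. omega u v = 0)
     \<and> (\<exists>v. (\<forall>j. v j \<in> \<Lambda>) \<and> Re (Omega v) \<noteq> 0)}"

text \<open>The Riemannian volume form of a subspace oriented by \<open>Re \<Omega>\<close>: the absolute value is the
  square root of the Gram determinant, and the sign is \<open>+1\<close> on frames that are positive for
  \<open>Re \<Omega>\<close>. It is only meant for vectors in one \<open>\<Lambda> \<in> \<L>\<G>\<^sup>+(n)\<close>.\<close>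

definition vol_form :: "('n \<Rightarrow> complex^'n) \<Rightarrow> real" where
  "vol_form v = sgn (Re (Omega v)) * sqrt (det (\<chi> i j. v i \<bullet> v j))"

definition phase :: "(complex^'n) set \<Rightarrow> real" where
  "phase \<Lambda> = (THE \<theta>. \<theta> \<in> {-pi/2<..<pi/2}
     \<and> (\<forall>v. (\<forall>j. v j \<in> \<Lambda>) \<longrightarrow> Omega v = cis \<theta> * complex_of_real (vol_form v)))"

definition orthogonal_decomposition ::
    "(complex^'n) set \<Rightarrow> real set \<Rightarrow> (real \<Rightarrow> (complex^'n) set) \<Rightarrow> bool" where
  "orthogonal_decomposition \<Lambda> A V \<longleftrightarrow>
     (\<forall>\<alpha>\<in>A. subspace (V \<alpha>) \<and> V \<alpha> \<noteq> {0})
     \<and> (\<forall>\<alpha>\<in>A. \<forall>\<beta>\<in>A. \<alpha> \<noteq> \<beta> \<longrightarrow> (\<forall>u\<in>V \<alpha>. \<forall>w\<in>V \<beta>. orthogonal u w))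
     \<and> span (\<Union>\<alpha>\<in>A. V \<alpha>) = \<Lambda>"

text \<open>The distinct angles \<open>\<alpha>\<^sub>1, \<dots>, \<alpha>\<^sub>k \<in> \<real>/\<pi>\<int>\<close> are given as the finite set \<open>A\<close> of their
  representatives in \<open>[0, \<pi>)\<close>, which also serves to index the summands. The equation
  \<open>e\<^sup>i\<^sup>\<alpha> V\<^sub>0 = V\<^sub>1\<close> between subspaces depends only on \<open>\<alpha>\<close> modulo \<open>\<pi>\<close>.\<close>

definition angle_decomposition ::
    "(complex^'n) set \<Rightarrow> (complex^'n) set \<Rightarrow> real set
      \<Rightarrow> (real \<Rightarrow> (complex^'n) set) \<Rightarrow> (real \<Rightarrow> (complex^'n) set) \<Rightarrow> bool" where
  "angle_decomposition \<Lambda>0 \<Lambda>1 A V0 V1 \<longleftrightarrow>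
     finite A \<and> A \<subseteq> {0..<pi}
     \<and> orthogonal_decomposition \<Lambda>0 A V0 \<and> orthogonal_decomposition \<Lambda>1 A V1
     \<and> (\<forall>\<alpha>\<in>A. (\<lambda>v. cis \<alpha> *s v) ` V0 \<alpha> = V1 \<alpha>)"

definition maslov_index :: "(complex^'n) set \<Rightarrow> (complex^'n) set \<Rightarrow> real" where
  "maslov_index \<Lambda>0 \<Lambda>1 = (THE m. \<exists>A V0 V1. angle_decomposition \<Lambda>0 \<Lambda>1 A V0 V1
     \<and> m = 1 / pi * ((\<Sum>\<alpha>\<in>A. real (dim (V0 \<alpha>)) * \<alpha>) + phase \<Lambda>0 - phase \<Lambda>1))"

text \<open>\<open>C\<^sup>\<infinity>\<close> on the closed interval \<open>[0,1]\<close>: derivatives of all orders exist, one-sided at the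
  end points.\<close>

definition smooth_on_unit :: "(real \<Rightarrow> 'a::real_normed_vector) \<Rightarrow> bool" where
  "smooth_on_unit f \<longleftrightarrow> (\<exists>D :: nat \<Rightarrow> real \<Rightarrow> 'a. D 0 = f
     \<and> (\<forall>k. \<forall>t\<in>{0..1}. (D k has_vector_derivative D (Suc k) t) (at t within {0..1})))"

abbreviation velocity :: "(real \<Rightarrow> 'a::real_normed_vector) \<Rightarrow> real \<Rightarrow> 'a" where
  "velocity \<Psi> t \<equiv> vector_derivative \<Psi> (at t within {0..1})"

definition lifting ::
    "(real \<Rightarrow> (complex^'n) set) \<Rightarrow> (real \<Rightarrow> (real^'n) \<Rightarrow>\<^sub>L (complex^'n)) \<Rightarrow> bool" where
  "lifting L \<Psi> \<longleftrightarrow> smooth_on_unit \<Psi> \<and> (\<forall>t\<in>{0..1}. bij_betw (blinfun_apply (\<Psi> t)) UNIV (L t))"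

text \<open>A path of subspaces is smooth as a path in the Grassmannian, equivalently in its
  submanifold \<open>\<L>\<G>\<^sup>+(n)\<close>, iff it has a smooth lifting.\<close>

definition smooth_LG_path :: "(real \<Rightarrow> (complex^'n) set) \<Rightarrow> bool" where
  "smooth_LG_path L \<longleftrightarrow> (\<forall>t\<in>{0..1}. L t \<in> LG_plus) \<and> (\<exists>\<Psi>. lifting L \<Psi>)"

definition quadratic_form_on :: "'a::real_vector set \<Rightarrow> ('a \<Rightarrow> real) \<Rightarrow> bool" where
  "quadratic_form_on S q \<longleftrightarrow> (\<exists>B. bilinear B \<and> (\<forall>u\<in>S. q u = B u u))"

text \<open>\<open>h t\<close> is \<open>d\<Lambda>\<^sub>t/dt\<close> as a quadratic form on \<open>\<Lambda>\<^sub>t\<close>; its values off \<open>\<Lambda>\<^sub>t\<close> are irrelevant.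
  The last clause is \<open>d(h\<^sub>t \<circ> \<Psi>\<^sub>t) = \<Psi>\<^sub>t\<^sup>*(i \<omega>)\<close>, with \<open>i\<close> the contraction by \<open>d\<Psi>\<^sub>t/dt\<close>,
  evaluated at the point \<open>x\<close>, where the vector field \<open>d\<Psi>\<^sub>t/dt\<close> along \<open>\<Psi>\<^sub>t\<close> has the value
  \<open>velocity \<Psi> t x\<close>. The form \<open>h t\<close> on \<open>\<Lambda>\<^sub>t\<close> does not depend on the lifting.\<close>

definition has_LG_derivative ::
    "(real \<Rightarrow> (complex^'n) set) \<Rightarrow> (real \<Rightarrow> complex^'n \<Rightarrow> real) \<Rightarrow> bool" where
  "has_LG_derivative L h \<longleftrightarrow> (\<exists>\<Psi>. lifting L \<Psi> \<and> (\<forall>t\<in>{0..1}.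
     quadratic_form_on (L t) (h t)
     \<and> (\<forall>x. ((\<lambda>y. h t (blinfun_apply (\<Psi> t) y)) has_derivative
           (\<lambda>w. omega (blinfun_apply (velocity \<Psi> t) x) (blinfun_apply (\<Psi> t) w))) (at x))))"

text \<open>The \<open>(n-1)\<close>-form obtained by contracting \<open>Re \<Omega>\<close> vanishes; inserting the contracted vector
  in any slot \<open>j\<close> instead of the first one changes at most the sign.\<close>

definition horizontal_lifting ::
    "(real \<Rightarrow> (complex^'n) set) \<Rightarrow> (real \<Rightarrow> (real^'n) \<Rightarrow>\<^sub>L (complex^'n)) \<Rightarrow> bool" where
  "horizontal_lifting L \<Psi> \<longleftrightarrow> lifting L \<Psi> \<and> (\<forall>t\<in>{0..1}. \<forall>x (w :: 'n \<Rightarrow> real^'n) j.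
     Re (Omega ((\<lambda>i. blinfun_apply (\<Psi> t) (w i))(j := blinfun_apply (velocity \<Psi> t) x))) = 0)"

text \<open>Two horizontal liftings differ by a constant automorphism of \<open>\<real>\<^sup>n\<close>, so the choice of \<open>\<Psi>\<close>
  does not matter.\<close>

definition LG_geodesic :: "(real \<Rightarrow> (complex^'n) set) \<Rightarrow> bool" where
  "LG_geodesic L \<longleftrightarrow> smooth_LG_path L \<and> (\<exists>h \<Psi>. has_LG_derivative L h \<and> horizontal_lifting L \<Psi>
     \<and> (\<forall>s\<in>{0..1}. \<forall>t\<in>{0..1}. \<forall>x. h s (blinfun_apply (\<Psi> s) x) = h t (blinfun_apply (\<Psi> t) x)))"

definition neg_semidefinite_on :: "'a::real_vector set \<Rightarrow> ('a \<Rightarrow> real) \<Rightarrow> bool" where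
  "neg_semidefinite_on S q \<longleftrightarrow> (\<forall>u\<in>S. q u \<le> 0)"

definition neg_definite_on :: "'a::real_vector set \<Rightarrow> ('a \<Rightarrow> real) \<Rightarrow> bool" where
  "neg_definite_on S q \<longleftrightarrow> (\<forall>u\<in>S. u \<noteq> 0 \<longrightarrow> q u < 0)"

definition transverse :: "'a::real_vector set \<Rightarrow> 'a set \<Rightarrow> bool" where
  "transverse S T \<longleftrightarrow> {u + v | u v. u \<in> S \<and> v \<in> T} = UNIV"

end

theory Submission
  imports Defs
begin

text \<open>
  Since the two subspaces are Lagrangian, \<open>\<Lambda>0\<close> has an orthonormal basis \<open>u\<^sub>1, \<dots>, u\<^sub>n\<close> which
  becomes an orthonormal basis of \<open>\<Lambda>1\<close> after multiplying \<open>u\<^sub>j\<close> by \<open>e\<^sup>i\<^sup>\<beta>\<close> for an angle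
  \<open>\<beta> = \<beta>\<^sub>j \<in> [0, \<pi>)\<close> (\<open>lagrangian_pair_frame\<close>). The geodesic is found among the paths that are
  diagonal in this basis, with the liftings
  \<open>\<Psi>\<^sub>t x = \<Sum>\<^sub>j x\<^sub>j g\<^sub>j(t) u\<^sub>j\<close>, where \<open>g\<^sub>j\<close> has modulus \<open>\<surd>\<rho>\<^sub>j\<close> and argument \<open>b\<^sub>j\<close>.
  Write \<open>\<theta> = phase \<Lambda>0 + \<Sum>\<^sub>j b\<^sub>j\<close> for the phase of the image of \<open>\<Psi>\<^sub>t\<close>. The derivative of the
  path is the form \<open>-1/2 \<Sum>\<^sub>j \<rho>\<^sub>j b'\<^sub>j x\<^sub>j\<^sup>2\<close>, so the geodesic equation says
  \<open>b'\<^sub>j = c\<^sub>j / \<rho>\<^sub>j\<close> with constants \<open>c\<^sub>j\<close>, and horizontality becomes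
  \<open>\<rho>'\<^sub>j = 2 c\<^sub>j tan \<theta>\<close>. These are the equations of the Lawlor necks. If all \<open>c\<^sub>j\<close> are
  nonnegative the derivative is negative semi-definite, and if they are positive it is
  negative definite.

  What remains is a boundary value problem: starting from \<open>b\<^sub>j = 0\<close>, reach \<open>b\<^sub>j = \<beta>\<^sub>j\<close> at time
  1. In such a frame the Maslov index is
  \<open>(\<Sum>\<^sub>j \<beta>\<^sub>j + phase \<Lambda>0 - phase \<Lambda>1) / \<pi>\<close> (\<open>maslov_index_frame\<close>), so its vanishing means that
  \<open>\<theta>\<close> has to increase from \<open>phase \<Lambda>0\<close> to \<open>phase \<Lambda>1\<close> and thus never leaves
  \<open>(-\<pi>/2, \<pi>/2)\<close>, where the equations are regular. Take \<open>\<theta>\<close> as the independent variable and start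
  with \<open>\<rho>\<^sub>j = 1\<close>. Then \<open>\<rho>\<^sub>j = 1 + c\<^sub>j s\<close> with a common function \<open>s\<close> of \<open>\<theta>\<close>, determined by the
  conservation law that \<open>cos\<^sup>2 \<theta> \<Prod>\<^sub>j \<rho>\<^sub>j\<close> is constant, and the increment of \<open>b\<^sub>j\<close> is the integral
  over \<open>\<theta>\<close> of the weight \<open>(c\<^sub>j/\<rho>\<^sub>j) / \<Sum>\<^sub>k (c\<^sub>k/\<rho>\<^sub>k)\<close>. The weights add up to 1. Hence
  the map from \<open>c\<close> in the standard simplex to the increments has its values in the simplex of vectors
  with the same sum as \<open>\<beta>\<close>, and it maps faces to faces, because \<open>c\<^sub>j = 0\<close> keeps \<open>b\<^sub>j\<close> constant.
  By Brouwer's theorem such a map is onto (\<open>face_preserving_map_onto\<close>), which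
  provides the right \<open>c\<close>. (If all \<open>\<beta>\<^sub>j\<close> vanish, take \<open>c = 0\<close>.) Finally \<open>c\<^sub>j = 0\<close> forces \<open>\<beta>\<^sub>j = 0\<close>, that is
  \<open>u\<^sub>j \<in> \<Lambda>0 \<inter> \<Lambda>1\<close>, which is impossible if \<open>\<Lambda>0\<close> and \<open>\<Lambda>1\<close> are transverse.
\<close>

section \<open>Unitary frames and Lagrangian subspaces\<close>

text \<open>The standard Hermitian form unites the two real forms of the problem: its real part is the
  inner product and its imaginary part is \<^const>\<open>omega\<close>. On a Lagrangian subspace it is therefore
  real, so that an orthonormal basis of a Lagrangian subspace is a unitary basis of \<open>\<complex>\<^sup>n\<close>.\<close>

definition herm :: "complex^'n \<Rightarrow> complex^'n \<Rightarrow> complex" where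
  "herm u v = (\<Sum>i\<in>UNIV. cnj (u $ i) * v $ i)"

lemma herm_add_left: "herm (u + v) w = herm u w + herm v w"
  by (simp add: herm_def distrib_right sum.distrib)

lemma herm_add_right: "herm w (u + v) = herm w u + herm w v"
  by (simp add: herm_def distrib_left sum.distrib)

lemma herm_mult_left: "herm (a *s u) v = cnj a * herm u v"
  by (simp add: herm_def sum_distrib_left mult.assoc)

lemma herm_mult_right: "herm u (a *s v) = a * herm u v"
  by (simp add: herm_def sum_distrib_left mult.left_commute)

lemma scaleR_eq_mult: "r *\<^sub>R (v :: complex^'n) = complex_of_real r *s v"
  by (simp add: vec_eq_iff scaleR_conv_of_real[where 'a=complex])

lemma herm_scaleR_left: "herm (r *\<^sub>R u) v = of_real r * herm u v"
  by (simp add: scaleR_eq_mult herm_mult_left)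

lemma herm_scaleR_right: "herm u (r *\<^sub>R v) = of_real r * herm u v"
  by (simp add: scaleR_eq_mult herm_mult_right)

lemma herm_zero [simp]: "herm 0 v = 0" "herm v 0 = 0"
  by (simp_all add: herm_def)

lemma herm_sum_left: "herm (\<Sum>i\<in>I. f i) v = (\<Sum>i\<in>I. herm (f i) v)"
  by (induction I rule: infinite_finite_induct) (simp_all add: herm_add_left)

lemma herm_sum_right: "herm v (\<Sum>i\<in>I. f i) = (\<Sum>i\<in>I. herm v (f i))"
  by (induction I rule: infinite_finite_induct) (simp_all add: herm_add_right)

lemma cnj_herm: "cnj (herm u v) = herm v u"
  by (simp add: herm_def mult.commute)

lemma Re_herm: "Re (herm u v) = u \<bullet> v"
  by (simp add: herm_def inner_vec_def inner_complex_def)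

lemma Im_herm: "Im (herm u v) = omega u v"
  by (simp add: herm_def omega_def algebra_simps)

lemma herm_self: "herm u u = of_real (u \<bullet> u)"
proof (rule complex_eqI)
  show "Im (herm u u) = Im (of_real (u \<bullet> u))" by (simp add: Im_herm omega_def mult.commute)
qed (simp add: Re_herm)

lemmas herm_simps = herm_add_left herm_add_right herm_mult_left herm_mult_right
  herm_scaleR_left herm_scaleR_right herm_sum_left herm_sum_right

text \<open>Lagrangian subspaces are handled below as the real spans of such frames, and indexing by the
  coordinate type makes \<^const>\<open>Omega\<close> applicable to them.\<close>

definition unitary_frame :: "('n \<Rightarrow> complex^'n) \<Rightarrow> bool" where
  "unitary_frame u \<longleftrightarrow> (\<forall>j k. herm (u j) (u k) = (if j = k then 1 else 0))"

lemma unitary_frameD: "unitary_frame u \<Longrightarrow> herm (u j) (u k) = (if j = k then 1 else 0)"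
  by (simp add: unitary_frame_def)

lemma unitary_frame_adjoint:
  assumes "unitary_frame (u :: 'n \<Rightarrow> complex^'n)"
  shows "(\<chi> k i. cnj (u k $ i)) ** (\<chi> i k. u k $ i) = (mat 1 :: complex^'n^'n)"
    and "(\<chi> i k. u k $ i) ** (\<chi> k i. cnj (u k $ i)) = (mat 1 :: complex^'n^'n)"
proof -
  show 1: "(\<chi> k i. cnj (u k $ i)) ** (\<chi> i k. u k $ i) = (mat 1 :: complex^'n^'n)"
    using assms by (simp add: matrix_matrix_mult_def mat_def vec_eq_iff unitary_frame_def herm_def)
  then show "(\<chi> i k. u k $ i) ** (\<chi> k i. cnj (u k $ i)) = (mat 1 :: complex^'n^'n)"
    using matrix_left_right_inverse by blast
qed

lemma unitary_frame_expansion: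
  fixes u :: "'n \<Rightarrow> complex^'n"
  assumes "unitary_frame u"
  shows "z = (\<Sum>k\<in>UNIV. herm (u k) z *s u k)"
proof -
  have "z = ((\<chi> i k. u k $ i) ** (\<chi> k i. cnj (u k $ i))) *v z"
    by (simp add: unitary_frame_adjoint[OF assms])
  also have "\<dots> = (\<chi> i k. u k $ i) *v ((\<chi> k i. cnj (u k $ i)) *v z)"
    by (simp add: matrix_vector_mul_assoc)
  also have "\<dots> = (\<Sum>k\<in>UNIV. herm (u k) z *s u k)"
    by (simp add: matrix_vector_mult_def herm_def vec_eq_iff mult.commute)
  finally show ?thesis .
qed

lemma cmod_Omega_unitary_frame:
  fixes u :: "'n \<Rightarrow> complex^'n"
  assumes "unitary_frame u"
  shows "cmod (Omega u) = 1"
proof -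
  have "det (\<chi> k i. cnj (u k $ i)) = det (transpose (\<chi> i k. cnj (u k $ i)))"
    by (simp add: transpose_def)
  also have "\<dots> = cnj (Omega u)"
    unfolding det_transpose Omega_def by (simp add: det_def)
  finally have "cnj (Omega u) * Omega u = 1"
    using arg_cong[OF unitary_frame_adjoint(1)[OF assms], of det]
    by (simp add: det_mul Omega_def)
  then have "(cmod (Omega u))\<^sup>2 = 1"
    by (metis complex_norm_square mult.commute of_real_eq_1_iff)
  then show ?thesis by (simp add: power2_eq_1_iff) (smt (verit) norm_ge_zero)
qed

lemma Omega_scale: "Omega (\<lambda>k. g k *s u k) = (\<Prod>k\<in>UNIV. g k) * Omega u"
proof -
  have "Omega (\<lambda>k. g k *s u k) = det (transpose (\<chi> i j. (g j *s u j) $ i))"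
    by (simp add: Omega_def)
  also have "transpose (\<chi> i j. (g j *s u j) $ i) = (\<chi> k. g k *s u k)"
    by (simp add: transpose_def vec_eq_iff)
  also have "det (\<chi> k. g k *s u k) = (\<Prod>k\<in>UNIV. g k) * det (\<chi> k. u k)"
    by (simp add: det_rows_mul)
  also have "(\<chi> k. u k) = transpose (\<chi> i j. u j $ i)"
    by (simp add: transpose_def vec_eq_iff)
  finally show ?thesis by (simp add: Omega_def)
qed

definition frame_map :: "('n \<Rightarrow> complex^'n) \<Rightarrow> real^'n \<Rightarrow> complex^'n" where
  "frame_map u x = (\<Sum>k\<in>UNIV. x $ k *\<^sub>R u k)"

lemma linear_frame_map: "linear (frame_map u)"
  by (rule linearI) (simp_all add: frame_map_def scaleR_add_left sum.distrib scaleR_sum_right)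

lemma frame_map_axis: "frame_map u (axis k 1) = u k"
proof -
  have "frame_map u (axis k 1) = (\<Sum>j\<in>UNIV. if j = k then u j else 0)"
    unfolding frame_map_def axis_def by (intro sum.cong) auto
  then show ?thesis by simp
qed

text \<open>\<^const>\<open>Omega\<close> on the real span of \<open>u\<close> is a real multiple of its value on \<open>u\<close>. This is
  what makes the phase of a Lagrangian subspace well defined, and what makes a velocity in the
  direction \<open>i e\<^sup>-\<^sup>i\<^sup>\<theta>\<close> horizontal at phase \<open>\<theta>\<close>.\<close>

lemma Omega_frame_map:
  "Omega (\<lambda>j. frame_map u (w j)) = of_real (det (\<chi> j k. w j $ k)) * Omega u"
proof -
  have "(\<chi> i j. frame_map u (w j) $ i) = (\<chi> i k. u k $ i) ** (\<chi> k j. complex_of_real (w j $ k))"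
    by (simp add: matrix_matrix_mult_def vec_eq_iff frame_map_def scaleR_conv_of_real[where 'a=complex] mult.commute)
  then have "Omega (\<lambda>j. frame_map u (w j)) = Omega u * det (\<chi> k j. complex_of_real (w j $ k))"
    by (simp add: Omega_def det_mul)
  also have "(\<chi> k j. complex_of_real (w j $ k)) = transpose (\<chi> j k. complex_of_real (w j $ k))"
    by (simp add: transpose_def)
  also have "det \<dots> = of_real (det (\<chi> j k. w j $ k))"
    unfolding det_transpose by (simp add: det_def)
  finally show ?thesis by (simp add: mult.commute)
qed

lemma herm_frame_map:
  assumes "unitary_frame u"
  shows "herm (u k) (frame_map u x) = of_real (x $ k)"
    and "herm (frame_map u x) (frame_map u y) = of_real (x \<bullet> y)"
proof -
  show 1: "herm (u k) (frame_map u x) = of_real (x $ k)" for k x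
  proof -
    have "herm (u k) (frame_map u x) = (\<Sum>j\<in>UNIV. if k = j then of_real (x $ j) else 0)"
      unfolding frame_map_def herm_simps unitary_frameD[OF assms] by (intro sum.cong) auto
    then show ?thesis by simp
  qed
  have "herm (frame_map u x) (frame_map u y) = (\<Sum>k\<in>UNIV. of_real (x $ k) * of_real (y $ k))"
    by (simp add: frame_map_def[of u x] herm_simps 1)
  then show "herm (frame_map u x) (frame_map u y) = of_real (x \<bullet> y)"
    by (simp add: inner_vec_def)
qed

lemma inj_frame_map: "unitary_frame u \<Longrightarrow> inj (frame_map u)"
  by (metis (no_types, lifting) herm_frame_map(1) injI of_real_eq_iff vec_eq_iff)

definition lagrangian :: "(complex^'n) set \<Rightarrow> bool" where
  "lagrangian \<Lambda> \<longleftrightarrow> subspace \<Lambda> \<and> dim \<Lambda> = CARD('n) \<and> (\<forall>u\<in>\<Lambda>. \<forall>v\<in>\<Lambda>. omega u v = 0)"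

lemma LG_plus_lagrangian: "\<Lambda> \<in> LG_plus \<Longrightarrow> lagrangian \<Lambda>"
  by (simp add: LG_plus_def lagrangian_def)

lemma lagrangian_herm: "lagrangian \<Lambda> \<Longrightarrow> u \<in> \<Lambda> \<Longrightarrow> v \<in> \<Lambda> \<Longrightarrow> herm u v = of_real (u \<bullet> v)"
  by (rule complex_eqI) (simp_all add: Re_herm Im_herm lagrangian_def)

lemma subspace_frame_span:
  fixes u :: "'n \<Rightarrow> complex^'n"
  assumes u: "unitary_frame u" and \<Lambda>: "subspace \<Lambda>" "dim \<Lambda> = CARD('n)" and mem: "\<And>k. u k \<in> \<Lambda>"
  shows "range (frame_map u) = \<Lambda>"
proof (rule subspace_dim_equal)
  show "subspace (range (frame_map u))"
    by (intro linear_subspace_image linear_frame_map) simp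
  show "range (frame_map u) \<subseteq> \<Lambda>"
    unfolding frame_map_def using mem \<Lambda>
    by (auto intro!: subspace_sum subspace_scale)
  have "dim (range (frame_map u)) = dim (UNIV :: (real^'n) set)"
    by (intro dim_image_eq linear_frame_map inj_on_subset[OF inj_frame_map[OF u]]) simp
  then show "dim \<Lambda> \<le> dim (range (frame_map u))" using \<Lambda> by simp
qed (use \<Lambda> in auto)

lemma lagrangian_range_frame_map:
  fixes u :: "'n \<Rightarrow> complex^'n"
  assumes u: "unitary_frame u"
  shows "lagrangian (range (frame_map u))"
proof -
  have "dim (range (frame_map u)) = dim (UNIV :: (real^'n) set)"
    by (intro dim_image_eq linear_frame_map inj_on_subset[OF inj_frame_map[OF u]]) simp
  moreover have "omega (frame_map u x) (frame_map u y) = 0" for x y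
    by (simp add: Im_herm[symmetric] herm_frame_map[OF u])
  ultimately show ?thesis
    by (auto simp: lagrangian_def intro!: linear_subspace_image linear_frame_map)
qed

lemma frame_of_orthonormal_set:
  fixes B :: "'a::real_inner set"
  assumes "card B = CARD('n)" "pairwise orthogonal B" "\<And>x. x \<in> B \<Longrightarrow> norm x = 1"
  obtains u :: "'n::finite \<Rightarrow> 'a" where "range u = B" "\<And>j k. u j \<bullet> u k = (if j = k then 1 else 0)"
proof -
  have "finite B" using assms(1) by (metis card.infinite zero_less_card_finite less_irrefl)
  then obtain u :: "'n \<Rightarrow> 'a" where u: "bij_betw u UNIV B"
    using finite_same_card_bij[of "UNIV :: 'n set" B] assms(1) by auto
  have "u j \<bullet> u k = (if j = k then 1 else 0)" for j k
  proof (cases "j = k")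
    case True
    have "norm (u k) = 1" using assms(3) u by (auto simp: bij_betw_def)
    then show ?thesis using True by (simp add: norm_eq_1)
  next
    case False
    then have "u j \<noteq> u k" using u by (auto simp: bij_betw_def inj_on_def)
    then show ?thesis using assms(2) u False by (auto simp: pairwise_def bij_betw_def orthogonal_def)
  qed
  then show ?thesis using that u by (auto simp: bij_betw_def)
qed

lemma lagrangian_frame:
  fixes \<Lambda> :: "(complex^'n) set"
  assumes \<Lambda>: "lagrangian \<Lambda>"
  obtains u where "unitary_frame u" "range (frame_map u) = \<Lambda>" "\<And>k. u k \<in> \<Lambda>"
proof -
  have sub: "subspace \<Lambda>" and dim: "dim \<Lambda> = CARD('n)"
    using \<Lambda> by (simp_all add: lagrangian_def)
  obtain B where B: "B \<subseteq> \<Lambda>" "pairwise orthogonal B" "\<And>x. x \<in> B \<Longrightarrow> norm x = 1" "card B = dim \<Lambda>"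
    by (rule orthonormal_basis_subspace[OF sub]) (rule that)
  obtain u :: "'n \<Rightarrow> complex^'n" where u: "range u = B" "\<And>j k. u j \<bullet> u k = (if j = k then 1 else 0)"
    by (rule frame_of_orthonormal_set[OF B(4)[unfolded dim] B(2,3)]) (assumption, rule that)
  have mem: "u k \<in> \<Lambda>" for k using u(1) B(1) by blast
  have uf: "unitary_frame u"
    using lagrangian_herm[OF \<Lambda> mem mem] u(2) by (simp add: unitary_frame_def)
  show ?thesis
    by (rule that[OF uf subspace_frame_span[OF uf sub dim mem] mem])
qed

section \<open>The phase in a unitary frame\<close>

text \<open>The determinant of a unitary frame has modulus 1, and the Gram determinant of other vectors of
  \<open>\<Lambda>\<close> is the square of the determinant of their coordinates. Hence \<^const>\<open>Omega\<close> of any vectors of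
  \<open>\<Lambda>\<close> is their signed volume times \<^term>\<open>Omega u\<close>, up to a sign that depends on the orientation of
  \<open>u\<close>.\<close>

lemma phase_unitary_frame:
  fixes \<Lambda> :: "(complex^'n) set"
  assumes \<Lambda>: "\<Lambda> \<in> LG_plus" and u: "unitary_frame u" "range (frame_map u) = \<Lambda>"
  shows "phase \<Lambda> \<in> {-pi/2<..<pi/2}" "\<exists>s\<in>{-1, 1}. Omega u = of_real s * cis (phase \<Lambda>)"
proof -
  have frame: "\<exists>w. v = (\<lambda>j. frame_map u (w j))" if "\<forall>j. v j \<in> \<Lambda>" for v :: "'n \<Rightarrow> complex^'n"
  proof -
    have "\<forall>j. \<exists>x. v j = frame_map u x" using that u(2) by blast
    then show ?thesis by metis
  qed
  obtain v where "\<forall>j. v j \<in> \<Lambda>" "Re (Omega v) \<noteq> 0"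
    using \<Lambda> by (auto simp: LG_plus_def)
  then obtain w where "Re (Omega (\<lambda>j. frame_map u (w j))) \<noteq> 0"
    using frame by metis
  then have Re_ne: "Re (Omega u) \<noteq> 0" by (auto simp: Omega_frame_map)
  define s where "s = sgn (Re (Omega u))"
  \<comment> \<open>The sign \<open>s\<close> moves \<open>Omega u\<close> to the right half plane, where \<open>arcsin\<close> of the imaginary part
    is the argument.\<close>
  define \<theta> where "\<theta> = arcsin (s * Im (Omega u))"
  have s: "s \<in> {-1, 1}" using Re_ne by (auto simp: s_def sgn_if)
  have ss: "s * s = 1" using s by auto
  have nrm: "(Re (Omega u))\<^sup>2 + (Im (Omega u))\<^sup>2 = 1"
    using cmod_Omega_unitary_frame[OF u(1)] by (metis cmod_power2 one_power2)
  have sRe: "s * Re (Omega u) > 0" using Re_ne by (auto simp: s_def sgn_if)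
  have "(s * Im (Omega u))\<^sup>2 < 1"
    using nrm Re_ne ss by (simp add: power_mult_distrib power2_eq_square[of s]) (smt (verit) zero_less_power2)
  then have Im_lt: "-1 < s * Im (Omega u)" "s * Im (Omega u) < 1"
    by (metis abs_square_less_1 abs_less_iff minus_less_iff)+
  have \<theta>: "\<theta> \<in> {-pi/2<..<pi/2}"
    unfolding \<theta>_def using arcsin_lt_bounded[OF Im_lt] by simp
  have "cis \<theta> = of_real s * Omega u"
  proof (rule complex_eqI)
    show "Im (cis \<theta>) = Im (of_real s * Omega u)"
      using Im_lt by (simp add: \<theta>_def)
    have "cos \<theta> = sqrt (1 - (s * Im (Omega u))\<^sup>2)"
      using Im_lt by (simp add: \<theta>_def cos_arcsin)
    also have "1 - (s * Im (Omega u))\<^sup>2 = (s * Re (Omega u))\<^sup>2"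
      using nrm ss by (simp add: power_mult_distrib power2_eq_square[of s] algebra_simps)
    also have "sqrt \<dots> = s * Re (Omega u)" using sRe by simp
    finally show "Re (cis \<theta>) = Re (of_real s * Omega u)" by simp
  qed
  then have Om: "Omega u = of_real s * cis \<theta>"
    using ss by (metis (no_types, lifting) mult.assoc mult_1 of_real_1 of_real_mult)
  have cos_pos: "cos \<theta> > 0" using \<theta> by (intro cos_gt_zero_pi) auto
  have gram: "vol_form (\<lambda>j. frame_map u (w j)) = s * det (\<chi> j k. w j $ k)" for w
  proof -
    let ?M = "\<chi> j k. w j $ k"
    have "(\<chi> i j. frame_map u (w i) \<bullet> frame_map u (w j)) = ?M ** transpose ?M"
      by (simp add: Re_herm[symmetric] herm_frame_map[OF u(1)] matrix_matrix_mult_def transpose_def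
          vec_eq_iff inner_vec_def)
    then have "sqrt (det (\<chi> i j. frame_map u (w i) \<bullet> frame_map u (w j))) = \<bar>det ?M\<bar>"
      by (simp add: det_mul)
    moreover have "sgn (Re (Omega (\<lambda>j. frame_map u (w j)))) = s * sgn (det ?M)"
      using cos_pos s by (auto simp: Omega_frame_map Om sgn_mult)
    ultimately show ?thesis by (simp add: vol_form_def mult.assoc sgn_mult_abs)
  qed
  have spec: "\<theta> \<in> {-pi/2<..<pi/2} \<and> (\<forall>v. (\<forall>j. v j \<in> \<Lambda>) \<longrightarrow> Omega v = cis \<theta> * complex_of_real (vol_form v))"
  proof (intro conjI allI impI \<theta>)
    fix v :: "'n \<Rightarrow> complex^'n" assume "\<forall>j. v j \<in> \<Lambda>"
    then obtain w where v: "v = (\<lambda>j. frame_map u (w j))" using frame by blast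
    show "Omega v = cis \<theta> * complex_of_real (vol_form v)"
      unfolding v gram by (simp add: Omega_frame_map Om)
  qed
  have "phase \<Lambda> = \<theta>"
    unfolding phase_def
  proof (rule the_equality, rule spec)
    fix \<psi> assume \<psi>: "\<psi> \<in> {-pi/2<..<pi/2} \<and> (\<forall>v. (\<forall>j. v j \<in> \<Lambda>) \<longrightarrow> Omega v = cis \<psi> * complex_of_real (vol_form v))"
    have mem: "u j \<in> \<Lambda>" for j using u(2) frame_map_axis[of u j] by (metis rangeI)
    have "vol_form u = s"
    proof -
      have "(\<chi> j k. axis j (1::real) $ k) = (mat 1 :: real^'n^'n)"
        by (simp add: vec_eq_iff axis_def mat_def)
      then show ?thesis using gram[of "\<lambda>j. axis j 1"] by (simp add: frame_map_axis del: axis_nth)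
    qed
    moreover have "Omega u = cis \<psi> * complex_of_real (vol_form u)" using \<psi> mem by blast
    ultimately have "of_real s * cis \<theta> = cis \<psi> * of_real s" using Om by simp
    then have "cis \<theta> = cis \<psi>" using s by auto
    then have "sin \<theta> = sin \<psi>" by (metis cis.simps(2))
    then show "\<psi> = \<theta>" using \<psi> \<theta> sin_inj_pi[of \<theta> \<psi>] by simp
  qed
  then show "phase \<Lambda> \<in> {-pi/2<..<pi/2}" "\<exists>s\<in>{-1, 1}. Omega u = of_real s * cis (phase \<Lambda>)"
    using \<theta> Om s by auto
qed

section \<open>Diagonalization of a pair of Lagrangian subspaces\<close>

text \<open>A maximum \<open>v\<close> of the Rayleigh quotient on the unit sphere is an eigenvector: moving from \<open>v\<close>
  in the direction \<open>y = \<kappa>v - fv\<close> would otherwise increase the quotient to first order.\<close>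

lemma symmetric_operator_eigenvector:
  fixes f :: "'a::euclidean_space \<Rightarrow> 'a"
  assumes S: "subspace S" "S \<noteq> {0}" and f: "linear f" "\<And>x. x \<in> S \<Longrightarrow> f x \<in> S"
    and sym: "\<And>x y. x \<in> S \<Longrightarrow> y \<in> S \<Longrightarrow> f x \<bullet> y = x \<bullet> f y"
  obtains v \<kappa> where "v \<in> S" "norm v = 1" "f v = \<kappa> *\<^sub>R v"
proof -
  let ?K = "S \<inter> sphere 0 1"
  have "compact ?K" using closed_subspace[OF S(1)] by (simp add: closed_Int_compact)
  moreover have "?K \<noteq> {}"
  proof -
    obtain x where x: "x \<in> S" "x \<noteq> 0" using S subspace_0 by blast
    then have "x /\<^sub>R norm x \<in> ?K" using S(1) by (simp add: subspace_scale)
    then show ?thesis by blast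
  qed
  moreover have "continuous_on ?K (\<lambda>x. x \<bullet> f x)"
    by (intro continuous_intros linear_continuous_on_compose[OF _ f(1)])
  ultimately obtain v where v: "v \<in> ?K" and max: "\<And>x. x \<in> ?K \<Longrightarrow> x \<bullet> f x \<le> v \<bullet> f v"
    using continuous_attains_sup[of ?K "\<lambda>x. x \<bullet> f x"] by blast
  define \<kappa> where "\<kappa> = v \<bullet> f v"
  have vS: "v \<in> S" and vv: "v \<bullet> v = 1" using v by (auto simp: norm_eq_1)
  have le: "x \<bullet> f x \<le> \<kappa> * (x \<bullet> x)" if x: "x \<in> S" for x
  proof (cases "x = 0")
    case False
    have "x /\<^sub>R norm x \<in> ?K" using S(1) x False by (simp add: subspace_scale)
    from max[OF this] have "(x \<bullet> f x) / (norm x)\<^sup>2 \<le> \<kappa>"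
      by (simp add: linear_scale[OF f(1)] \<kappa>_def power2_eq_square divide_inverse mult_ac)
    then show ?thesis using False by (simp add: field_simps power2_norm_eq_inner[symmetric])
  qed simp
  define y where "y = \<kappa> *\<^sub>R v - f v"
  have yS: "y \<in> S" using vS f(2) S(1) by (simp add: y_def subspace_diff subspace_scale)
  define a where "a = y \<bullet> y"
  define b where "b = \<kappa> * (y \<bullet> y) - y \<bullet> f y"
  have quad: "0 \<le> 2 * t * a + t\<^sup>2 * b" for t
  proof -
    have "v + t *\<^sub>R y \<in> S" using vS yS S(1) by (simp add: subspace_add subspace_scale)
    from le[OF this]
    have "0 \<le> \<kappa> * ((v + t *\<^sub>R y) \<bullet> (v + t *\<^sub>R y)) - (v + t *\<^sub>R y) \<bullet> (f v + t *\<^sub>R f y)"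
      by (simp add: linear_add[OF f(1)] linear_scale[OF f(1)])
    also have "\<dots> = 2 * t * (\<kappa> * (v \<bullet> y) - f v \<bullet> y) + t\<^sup>2 * b"
      using sym[OF vS yS] vv
      by (simp add: b_def inner_add_left inner_add_right \<kappa>_def power2_eq_square algebra_simps inner_commute)
    also have "\<kappa> * (v \<bullet> y) - f v \<bullet> y = a"
      by (simp add: a_def y_def inner_diff_left)
    finally show ?thesis .
  qed
  have "a = 0"
  proof (rule ccontr)
    assume "a \<noteq> 0"
    then have a: "a > 0" by (simp add: a_def)
    \<comment> \<open>At this \<open>t\<close> the linear term of \<open>2ta + t\<^sup>2b\<close> dominates, whatever the sign of \<open>b\<close>.\<close>
    define t where "t = - a / (\<bar>b\<bar> + 1)"
    have "t * (\<bar>b\<bar> + 1) = - a" by (simp add: t_def)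
    then have "t\<^sup>2 * (\<bar>b\<bar> + 1) = - t * a" by (simp add: power2_eq_square mult.assoc)
    moreover have "t\<^sup>2 * b \<le> t\<^sup>2 * (\<bar>b\<bar> + 1)" by (intro mult_left_mono) auto
    ultimately have "0 \<le> t * a" using quad[of t] by linarith
    moreover have "t < 0" using a by (simp add: t_def)
    ultimately show False using a by (simp add: zero_le_mult_iff)
  qed
  then have "f v = \<kappa> *\<^sub>R v" by (simp add: a_def y_def)
  then show ?thesis using that vS v by simp
qed

text \<open>Eigenspaces of \<open>f\<close> are invariant under \<open>g\<close>, so there is a common eigenvector, and its
  orthogonal complement in \<open>S\<close> is again invariant under both operators.\<close>

lemma commuting_symmetric_operators_diagonalization:
  fixes f g :: "'a::euclidean_space \<Rightarrow> 'a"
  assumes "subspace S" and f: "linear f" "\<And>x. x \<in> S \<Longrightarrow> f x \<in> S"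
    and g: "linear g" "\<And>x. x \<in> S \<Longrightarrow> g x \<in> S"
    and symf: "\<And>x y. x \<in> S \<Longrightarrow> y \<in> S \<Longrightarrow> f x \<bullet> y = x \<bullet> f y"
    and symg: "\<And>x y. x \<in> S \<Longrightarrow> y \<in> S \<Longrightarrow> g x \<bullet> y = x \<bullet> g y"
    and comm: "\<And>x. x \<in> S \<Longrightarrow> f (g x) = g (f x)"
  shows "\<exists>B. B \<subseteq> S \<and> finite B \<and> card B = dim S \<and> pairwise orthogonal B \<and>
    (\<forall>v\<in>B. norm v = 1 \<and> (\<exists>\<kappa>. f v = \<kappa> *\<^sub>R v) \<and> (\<exists>\<mu>. g v = \<mu> *\<^sub>R v))"
  using assms
proof (induction "dim S" arbitrary: S)
  case 0
  then show ?case by (intro exI[of _ "{}"]) auto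
next
  case (Suc d)
  note S = \<open>subspace S\<close>
  have S0: "S \<noteq> {0}" using Suc.hyps(2) by auto
  obtain v0 \<kappa> where v0: "v0 \<in> S" "norm v0 = 1" "f v0 = \<kappa> *\<^sub>R v0"
    using symmetric_operator_eigenvector[OF S S0 Suc.prems(2,3,6)] by blast
  define E where "E = {x \<in> S. f x = \<kappa> *\<^sub>R x}"
  have E: "subspace E" using S linear_0[OF f(1)]
    by (auto simp: subspace_def E_def linear_add[OF f(1)] linear_scale[OF f(1)] scaleR_add_right)
  have "v0 \<in> E" "v0 \<noteq> 0" using v0 by (auto simp: E_def)
  then have E0: "E \<noteq> {0}" by blast
  have gE: "g x \<in> E" if "x \<in> E" for x
    using that Suc.prems(5,8) by (auto simp: E_def linear_scale[OF g(1)])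
  obtain v \<mu> where v: "v \<in> E" "norm v = 1" "g v = \<mu> *\<^sub>R v"
    using symmetric_operator_eigenvector[OF E E0 g(1) gE] Suc.prems(7) by (auto simp: E_def)
  have vS: "v \<in> S" and fv: "f v = \<kappa> *\<^sub>R v" using v by (auto simp: E_def)
  define S' where "S' = {y \<in> S. \<forall>x\<in>span {v}. orthogonal x y}"
  have S'_iff: "y \<in> S' \<longleftrightarrow> y \<in> S \<and> v \<bullet> y = 0" for y
    by (auto simp: S'_def span_singleton orthogonal_def)
  have S': "subspace S'" using S by (auto simp: subspace_def S'_iff inner_add_right)
  have "dim S' + dim (span {v}) = dim S"
    unfolding S'_def by (rule dim_subspace_orthogonal_to_vectors) (use S vS in \<open>auto intro: span_minimal[THEN subsetD]\<close>)
  moreover have "dim (span {v}) = 1" using v(2) by (metis dim_singleton dim_span norm_zero zero_neq_one)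
  ultimately have dimS': "d = dim S'" using Suc.hyps(2) by simp
  have "\<exists>B. B \<subseteq> S' \<and> finite B \<and> card B = dim S' \<and> pairwise orthogonal B \<and>
    (\<forall>v\<in>B. norm v = 1 \<and> (\<exists>\<kappa>. f v = \<kappa> *\<^sub>R v) \<and> (\<exists>\<mu>. g v = \<mu> *\<^sub>R v))"
  proof (rule Suc.hyps(1)[OF dimS' S' f(1) _ g(1)])
    show "f x \<in> S'" if "x \<in> S'" for x
      using that Suc.prems(3) Suc.prems(6)[OF vS, of x] by (simp add: S'_iff fv)
    show "g x \<in> S'" if "x \<in> S'" for x
      using that Suc.prems(5) Suc.prems(7)[OF vS, of x] by (simp add: S'_iff v(3))
    show "f x \<bullet> y = x \<bullet> f y" if "x \<in> S'" "y \<in> S'" for x y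
      using that by (intro Suc.prems(6)) (simp_all add: S'_iff)
    show "g x \<bullet> y = x \<bullet> g y" if "x \<in> S'" "y \<in> S'" for x y
      using that by (intro Suc.prems(7)) (simp_all add: S'_iff)
    show "f (g x) = g (f x)" if "x \<in> S'" for x
      using that by (intro Suc.prems(8)) (simp add: S'_iff)
  qed
  then obtain B where B: "B \<subseteq> S'" "finite B" "card B = dim S'" "pairwise orthogonal B"
    "\<forall>v\<in>B. norm v = 1 \<and> (\<exists>\<kappa>. f v = \<kappa> *\<^sub>R v) \<and> (\<exists>\<mu>. g v = \<mu> *\<^sub>R v)" by blast
  have "v \<notin> B" using B(1) v(2) by (auto simp: S'_iff)
  moreover have "insert v B \<subseteq> S" using vS B(1) by (auto simp: S'_iff)
  moreover have "pairwise orthogonal (insert v B)"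
  proof -
    have "orthogonal v y \<and> orthogonal y v" if "y \<in> B" for y
    proof -
      have "v \<bullet> y = 0" using that B(1) S'_iff by blast
      then show ?thesis by (simp add: orthogonal_def inner_commute)
    qed
    then show ?thesis using B(4) by (simp add: pairwise_insert)
  qed
  moreover have "card (insert v B) = dim S"
    using B(2,3) \<open>v \<notin> B\<close> dimS' Suc.hyps(2) by simp
  ultimately show ?case
    using B(2,5) v(2,3) fv by (intro exI[of _ "insert v B"]) (intro conjI; blast)
qed

text \<open>The antilinear reflection that fixes the real span of \<open>w\<close> and is \<open>-1\<close> on its multiple
  by \<open>i\<close>. A vector \<open>v\<close> satisfies \<open>e\<^sup>i\<^sup>\<beta>v \<in> \<Lambda>1\<close>, with \<open>\<Lambda>1\<close> this real span, exactly if its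
  reflection is \<open>e\<^sup>2\<^sup>i\<^sup>\<beta>v\<close>; in this way the search for the angles becomes an eigenvalue
  problem.\<close>

definition frame_conj :: "('n \<Rightarrow> complex^'n) \<Rightarrow> complex^'n \<Rightarrow> complex^'n" where
  "frame_conj w z = (\<Sum>j\<in>UNIV. cnj (herm (w j) z) *s w j)"

lemma frame_conj_mult: "frame_conj w (a *s z) = cnj a *s frame_conj w z"
  by (simp add: frame_conj_def herm_mult_right vec.scale_sum_right)

lemma frame_conj_add: "frame_conj w (x + y) = frame_conj w x + frame_conj w y"
  by (simp add: frame_conj_def herm_add_right vec.scale_left_distrib sum.distrib)

lemma herm_frame_conj: "unitary_frame w \<Longrightarrow> herm (w k) (frame_conj w z) = cnj (herm (w k) z)"
proof -
  assume w: "unitary_frame w"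
  have "herm (w k) (frame_conj w z) = (\<Sum>j\<in>UNIV. if k = j then cnj (herm (w j) z) else 0)"
    unfolding frame_conj_def herm_simps unitary_frameD[OF w] by (intro sum.cong) auto
  then show ?thesis by simp
qed

lemma frame_conj_involution: "unitary_frame w \<Longrightarrow> frame_conj w (frame_conj w z) = z"
  using unitary_frame_expansion[of w z] by (simp add: frame_conj_def[of w "frame_conj w z"] herm_frame_conj)

lemma herm_frame_conj_symmetric: "herm (frame_conj w x) y = herm (frame_conj w y) x"
  by (simp add: frame_conj_def herm_simps mult.commute)

lemma frame_conj_fixed_imp_range:
  assumes w: "unitary_frame w" and "frame_conj w z = z"
  shows "z \<in> range (frame_map w)"
proof -
  have "cnj (herm (w k) z) = herm (w k) z" for k
    using herm_frame_conj[OF w, of k z] assms(2) by simp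
  then have "herm (w k) z = of_real (Re (herm (w k) z))" for k
    by (metis complex_is_Real_iff Reals_cnj_iff of_real_Re)
  then have "z = frame_map w (\<chi> k. Re (herm (w k) z))"
    using unitary_frame_expansion[OF w, of z] by (simp add: frame_map_def scaleR_eq_mult)
  then show ?thesis by blast
qed

text \<open>In an orthonormal basis \<open>e\<close> of \<open>\<Lambda>0\<close>, the reflection in \<open>\<Lambda>1\<close> restricted to
  \<open>\<Lambda>0\<close> has real part \<open>f\<close> and imaginary part \<open>g\<close>. Both are symmetric because
  \<^term>\<open>herm (frame_conj w x) y\<close> is symmetric in \<open>x\<close> and \<open>y\<close>, and they commute because the
  reflection is an involution. On a common eigenvector the reflection multiplies by some complex number
  \<open>m\<close>; again by the involution \<open>m\<close> has modulus 1, and the angle is half its argument.\<close>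

lemma lagrangian_pair_frame:
  fixes \<Lambda>0 \<Lambda>1 :: "(complex^'n) set"
  assumes "lagrangian \<Lambda>0" and "lagrangian \<Lambda>1"
  obtains u \<beta> where "unitary_frame u" "range (frame_map u) = \<Lambda>0"
    "\<And>j. \<beta> j \<in> {0..<pi}" "range (frame_map (\<lambda>j. cis (\<beta> j) *s u j)) = \<Lambda>1"
    "unitary_frame (\<lambda>j. cis (\<beta> j) *s u j)"
proof -
  obtain e where e: "unitary_frame e" "range (frame_map e) = \<Lambda>0"
    by (rule lagrangian_frame[OF assms(1)]) (rule that)
  obtain w where w: "unitary_frame w" "range (frame_map w) = \<Lambda>1"
    by (rule lagrangian_frame[OF assms(2)]) (rule that)
  let ?\<phi> = "frame_map e" and ?\<tau> = "frame_conj w"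
  define f where "f x = (\<chi> j. Re (herm (e j) (?\<tau> (?\<phi> x))))" for x
  define g where "g x = (\<chi> j. Im (herm (e j) (?\<tau> (?\<phi> x))))" for x
  have \<tau>\<phi>: "?\<tau> (?\<phi> x) = ?\<phi> (f x) + \<i> *s ?\<phi> (g x)" for x
  proof -
    have "?\<tau> (?\<phi> x) = (\<Sum>j\<in>UNIV. herm (e j) (?\<tau> (?\<phi> x)) *s e j)"
      by (rule unitary_frame_expansion[OF e(1)])
    also have "\<dots> = (\<Sum>j\<in>UNIV. complex_of_real (f x $ j) *s e j + \<i> *s (complex_of_real (g x $ j) *s e j))"
    proof (rule sum.cong)
      fix j
      have "herm (e j) (?\<tau> (?\<phi> x)) = complex_of_real (f x $ j) + \<i> * complex_of_real (g x $ j)"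
        by (simp add: f_def g_def complex_eq_iff)
      then show "herm (e j) (?\<tau> (?\<phi> x)) *s e j = complex_of_real (f x $ j) *s e j + \<i> *s (complex_of_real (g x $ j) *s e j)"
        by (simp add: vec.scale_left_distrib)
    qed simp
    finally show ?thesis
      by (simp add: frame_map_def scaleR_eq_mult sum.distrib vec.scale_sum_right)
  qed
  have lin_re: "?\<tau> (?\<phi> (x + y)) = ?\<tau> (?\<phi> x) + ?\<tau> (?\<phi> y)"
    "?\<tau> (?\<phi> (r *\<^sub>R x)) = r *\<^sub>R ?\<tau> (?\<phi> x)" for x y r
    by (simp_all add: linear_add[OF linear_frame_map] linear_scale[OF linear_frame_map]
        frame_conj_add scaleR_eq_mult frame_conj_mult)
  have f: "linear f" and g: "linear g"
    by (auto intro!: linearI simp: f_def g_def vec_eq_iff lin_re herm_simps)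
  have h: "herm (?\<phi> x) (?\<tau> (?\<phi> y)) = of_real (x \<bullet> f y) + \<i> * of_real (x \<bullet> g y)" for x y
    by (simp add: \<tau>\<phi> herm_simps herm_frame_map[OF e(1)])
  have hsym: "herm (?\<phi> x) (?\<tau> (?\<phi> y)) = herm (?\<phi> y) (?\<tau> (?\<phi> x))" for x y
    by (metis cnj_herm herm_frame_conj_symmetric)
  have symf: "f x \<bullet> y = x \<bullet> f y" and symg: "g x \<bullet> y = x \<bullet> g y" for x y
    using hsym[of y x] unfolding h by (auto simp: complex_eq_iff inner_commute)
  have comm: "f (g x) = g (f x)" for x
  proof -
    have "?\<phi> x = ?\<tau> (?\<phi> (f x) + \<i> *s ?\<phi> (g x))"
      using frame_conj_involution[OF w(1), of "?\<phi> x"] \<tau>\<phi>[of x] by simp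
    also have "\<dots> = ?\<phi> (f (f x)) + \<i> *s ?\<phi> (g (f x)) + (- \<i>) *s (?\<phi> (f (g x)) + \<i> *s ?\<phi> (g (g x)))"
      by (simp add: frame_conj_add frame_conj_mult \<tau>\<phi>)
    finally have "herm (e k) (?\<phi> x) = herm (e k) (?\<phi> (f (f x)) + \<i> *s ?\<phi> (g (f x)) + (- \<i>) *s (?\<phi> (f (g x)) + \<i> *s ?\<phi> (g (g x))))" for k
      by simp
    then have "complex_of_real (x $ k) = of_real (f (f x) $ k) + \<i> * of_real (g (f x) $ k)
        + (- \<i>) * (of_real (f (g x) $ k) + \<i> * of_real (g (g x) $ k))" for k
      by (simp only: herm_simps herm_frame_map(1)[OF e(1)])
    from arg_cong[OF this, of Im] show ?thesis by (simp add: vec_eq_iff)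
  qed
  obtain B where B: "card B = CARD('n)" "pairwise orthogonal B"
    "\<And>v. v \<in> B \<Longrightarrow> norm v = 1" "\<And>v. v \<in> B \<Longrightarrow> \<exists>a. f v = a *\<^sub>R v" "\<And>v. v \<in> B \<Longrightarrow> \<exists>b. g v = b *\<^sub>R v"
    using commuting_symmetric_operators_diagonalization[of UNIV f g] f g symf symg comm by auto
  obtain v :: "'n \<Rightarrow> real^'n" where v: "range v = B" "\<And>j k. v j \<bullet> v k = (if j = k then 1 else 0)"
    using frame_of_orthonormal_set[OF B(1-3)] by blast
  define u where "u j = ?\<phi> (v j)" for j
  have u: "unitary_frame u"
    using v(2) by (simp add: unitary_frame_def u_def herm_frame_map[OF e(1)])
  have range_u: "range (frame_map u) = \<Lambda>0"
    using assms(1) e(2) by (intro subspace_frame_span[OF u]) (auto simp: lagrangian_def u_def)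
  have "\<exists>\<beta>\<in>{0..<pi}. cis \<beta> *s u j \<in> \<Lambda>1" for j
  proof -
    obtain a b where ab: "f (v j) = a *\<^sub>R v j" "g (v j) = b *\<^sub>R v j" using B(4,5) v(1) by blast
    define m where "m = Complex a b"
    have \<tau>u: "?\<tau> (u j) = m *s u j"
    proof -
      have "?\<tau> (u j) = complex_of_real a *s u j + \<i> *s (complex_of_real b *s u j)"
        unfolding u_def \<tau>\<phi> ab by (simp add: linear_scale[OF linear_frame_map] scaleR_eq_mult)
      also have "\<dots> = m *s u j" by (simp add: vec_eq_iff m_def complex_eq_iff)
      finally show ?thesis .
    qed
    have "u j = (cnj m * m) *s u j"
      using frame_conj_involution[OF w(1), of "u j"] by (simp add: \<tau>u frame_conj_mult)
    then have "herm (u j) (u j) = (cnj m * m) * herm (u j) (u j)"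
      by (metis herm_mult_right)
    then have "cnj m * m = 1" using unitary_frameD[OF u, of j j] by simp
    then have "(cmod m)\<^sup>2 = 1"
      by (metis complex_norm_square mult.commute of_real_eq_1_iff)
    then have "cmod m = 1"
      by (simp add: power2_eq_1_iff) (smt (verit) norm_ge_zero)
    define \<beta> where "\<beta> = Arg2pi m / 2"
    have m: "m = cis \<beta> * cis \<beta>"
      using Arg2pi_eq[of m] \<open>cmod m = 1\<close> by (simp add: cis_mult \<beta>_def) (simp add: cis_conv_exp)
    have "?\<tau> (cis \<beta> *s u j) = (cnj (cis \<beta>) * m) *s u j"
      by (simp add: frame_conj_mult \<tau>u)
    also have "cnj (cis \<beta>) * m = cis \<beta>" by (simp add: m cis_cnj cis_mult)
    finally have "cis \<beta> *s u j \<in> \<Lambda>1"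
      using frame_conj_fixed_imp_range[OF w(1)] w(2) by blast
    moreover have "\<beta> \<in> {0..<pi}" using Arg2pi[of m] by (simp add: \<beta>_def)
    ultimately show ?thesis by blast
  qed
  then obtain \<beta> where \<beta>: "\<And>j. \<beta> j \<in> {0..<pi}" "\<And>j. cis (\<beta> j) *s u j \<in> \<Lambda>1" by metis
  have cu: "unitary_frame (\<lambda>j. cis (\<beta> j) *s u j)"
    using u by (simp add: unitary_frame_def herm_simps cis_cnj cis_mult)
  have "range (frame_map (\<lambda>j. cis (\<beta> j) *s u j)) = \<Lambda>1"
    using assms(2) \<beta>(2) by (intro subspace_frame_span[OF cu]) (auto simp: lagrangian_def)
  then show ?thesis using that u range_u \<beta>(1) cu by blast
qed

section \<open>The Maslov index in a diagonalizing frame\<close>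

lemma span_UN_decompose:
  fixes V :: "'i \<Rightarrow> 'a::real_vector set"
  assumes "finite A" and V: "\<And>i. i \<in> A \<Longrightarrow> subspace (V i)" and "v \<in> span (\<Union>i\<in>A. V i)"
  shows "\<exists>p. (\<forall>i\<in>A. p i \<in> V i) \<and> v = (\<Sum>i\<in>A. p i)"
  using assms(3)
proof (induction rule: span_induct_alt)
  case base
  show ?case using V by (intro exI[of _ "\<lambda>_. 0"]) (simp add: subspace_0)
next
  case (step c x y)
  then obtain p i where p: "\<forall>i\<in>A. p i \<in> V i" "y = (\<Sum>i\<in>A. p i)" and i: "i \<in> A" "x \<in> V i" by blast
  let ?q = "\<lambda>j. (if j = i then c *\<^sub>R x else 0) + p j"
  have "\<forall>j\<in>A. ?q j \<in> V j"
    using p(1) i V by (auto intro!: subspace_add subspace_scale)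
  moreover have "c *\<^sub>R x + y = (\<Sum>j\<in>A. ?q j)"
    using \<open>finite A\<close> i(1) p(2) by (simp add: sum.distrib)
  ultimately show ?case by (intro exI[of _ ?q] conjI)
qed

text \<open>The summand of angle \<open>\<alpha>\<close> in any angle decomposition must be this space. It is defined without
  reference to a decomposition, which is the reason why the decomposition is unique and the Maslov index
  well defined.\<close>

definition angle_space :: "(complex^'n) set \<Rightarrow> (complex^'n) set \<Rightarrow> real \<Rightarrow> (complex^'n) set" where
  "angle_space \<Lambda>0 \<Lambda>1 \<alpha> = {v \<in> \<Lambda>0. cis \<alpha> *s v \<in> \<Lambda>1}"

lemma angle_decomposition_subset:
  assumes "angle_decomposition \<Lambda>0 \<Lambda>1 A V0 V1" "\<gamma> \<in> A"
  shows "V0 \<gamma> \<subseteq> angle_space \<Lambda>0 \<Lambda>1 \<gamma>"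
proof -
  have "V0 \<gamma> \<subseteq> span (\<Union>\<alpha>\<in>A. V0 \<alpha>)" "V1 \<gamma> \<subseteq> span (\<Union>\<alpha>\<in>A. V1 \<alpha>)"
    using assms(2) by (auto intro: span_base)
  then have "V0 \<gamma> \<subseteq> \<Lambda>0" "V1 \<gamma> \<subseteq> \<Lambda>1"
    using assms(1) by (simp_all add: angle_decomposition_def orthogonal_decomposition_def)
  moreover have "(\<lambda>v. cis \<gamma> *s v) ` V0 \<gamma> = V1 \<gamma>"
    using assms by (simp add: angle_decomposition_def)
  ultimately show ?thesis by (auto simp: angle_space_def)
qed

text \<open>Expand both \<open>v\<close> and \<open>e\<^sup>i\<^sup>\<alpha>v\<close> along the decompositions. The summands of \<open>\<Lambda>0\<close> are
  orthogonal for the Hermitian form, which is real on \<open>\<Lambda>0\<close>, so pairing with the component \<open>p\<close> of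
  \<open>v\<close> at the angle \<open>\<gamma>\<close> shows that \<open>e\<^sup>i\<^sup>(\<^sup>\<alpha>\<^sup>-\<^sup>\<gamma>\<^sup>) |p|\<^sup>2\<close> is real. As
  \<open>|\<alpha> - \<gamma>| < \<pi>\<close>, this forces \<open>\<gamma> = \<alpha>\<close> or \<open>p = 0\<close>.\<close>

lemma angle_space_cases:
  fixes \<Lambda>0 \<Lambda>1 :: "(complex^'n) set"
  assumes \<Lambda>0: "lagrangian \<Lambda>0" and dec: "angle_decomposition \<Lambda>0 \<Lambda>1 A V0 V1"
    and \<alpha>: "\<alpha> \<in> {0..<pi}" and v: "v \<in> angle_space \<Lambda>0 \<Lambda>1 \<alpha>"
  shows "if \<alpha> \<in> A then v \<in> V0 \<alpha> else v = 0"
proof -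
  have A: "finite A" "A \<subseteq> {0..<pi}"
    and d0: "orthogonal_decomposition \<Lambda>0 A V0" and d1: "orthogonal_decomposition \<Lambda>1 A V1"
    and V1: "\<And>\<gamma>. \<gamma> \<in> A \<Longrightarrow> (\<lambda>v. cis \<gamma> *s v) ` V0 \<gamma> = V1 \<gamma>"
    using dec by (auto simp: angle_decomposition_def)
  have sub0: "subspace (V0 \<gamma>)" and sub1: "subspace (V1 \<gamma>)" if "\<gamma> \<in> A" for \<gamma>
    using d0 d1 that by (auto simp: orthogonal_decomposition_def)
  have V0_sub: "V0 \<gamma> \<subseteq> \<Lambda>0" if "\<gamma> \<in> A" for \<gamma>
    using angle_decomposition_subset[OF dec that] by (auto simp: angle_space_def)
  have herm0: "herm x y = 0" if "x \<in> V0 \<gamma>" "y \<in> V0 \<delta>" "\<gamma> \<in> A" "\<delta> \<in> A" "\<gamma> \<noteq> \<delta>" for x y \<gamma> \<delta>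
  proof -
    have "x \<bullet> y = 0" using d0 that by (auto simp: orthogonal_decomposition_def orthogonal_def)
    then show ?thesis using lagrangian_herm[OF \<Lambda>0, of x y] V0_sub that by auto
  qed
  have "v \<in> span (\<Union>\<gamma>\<in>A. V0 \<gamma>)" using v d0 by (auto simp: angle_space_def orthogonal_decomposition_def)
  then have "\<exists>p. (\<forall>\<gamma>\<in>A. p \<gamma> \<in> V0 \<gamma>) \<and> v = (\<Sum>\<gamma>\<in>A. p \<gamma>)"
    by (intro span_UN_decompose A(1) sub0)
  then obtain p where p: "\<And>\<gamma>. \<gamma> \<in> A \<Longrightarrow> p \<gamma> \<in> V0 \<gamma>" and v_eq: "v = (\<Sum>\<gamma>\<in>A. p \<gamma>)"
    by blast
  have "cis \<alpha> *s v \<in> span (\<Union>\<gamma>\<in>A. V1 \<gamma>)" using v d1 by (auto simp: angle_space_def orthogonal_decomposition_def)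
  then have "\<exists>r. (\<forall>\<gamma>\<in>A. r \<gamma> \<in> V1 \<gamma>) \<and> cis \<alpha> *s v = (\<Sum>\<gamma>\<in>A. r \<gamma>)"
    by (intro span_UN_decompose A(1) sub1)
  then obtain r where r: "\<And>\<gamma>. \<gamma> \<in> A \<Longrightarrow> r \<gamma> \<in> V1 \<gamma>" and cv_eq: "cis \<alpha> *s v = (\<Sum>\<gamma>\<in>A. r \<gamma>)"
    by blast
  have "\<exists>q\<in>V0 \<gamma>. r \<gamma> = cis \<gamma> *s q" if "\<gamma> \<in> A" for \<gamma> using r[OF that] V1[OF that] by blast
  then obtain q where q: "\<And>\<gamma>. \<gamma> \<in> A \<Longrightarrow> q \<gamma> \<in> V0 \<gamma>" and r_eq: "\<And>\<gamma>. \<gamma> \<in> A \<Longrightarrow> r \<gamma> = cis \<gamma> *s q \<gamma>"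
    by metis
  have p0: "p \<gamma> = 0" if \<gamma>: "\<gamma> \<in> A" "\<gamma> \<noteq> \<alpha>" for \<gamma>
  proof -
    have pick: "(\<Sum>\<delta>\<in>A. a \<delta> * herm (p \<gamma>) (x \<delta>)) = a \<gamma> * herm (p \<gamma>) (x \<gamma>)"
      if x: "\<And>\<delta>. \<delta> \<in> A \<Longrightarrow> x \<delta> \<in> V0 \<delta>" for a x
    proof -
      have "herm (p \<gamma>) (x \<delta>) = 0" if "\<delta> \<in> A" "\<gamma> \<noteq> \<delta>" for \<delta>
        by (rule herm0[OF p[OF \<gamma>(1)] x[OF that(1)] \<gamma>(1) that])
      then have "(\<Sum>\<delta>\<in>A. a \<delta> * herm (p \<gamma>) (x \<delta>)) = (\<Sum>\<delta>\<in>A. if \<gamma> = \<delta> then a \<delta> * herm (p \<gamma>) (x \<delta>) else 0)"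
        by (intro sum.cong) auto
      then show ?thesis using A(1) \<gamma>(1) by simp
    qed
    have "herm (p \<gamma>) (cis \<alpha> *s v) = (\<Sum>\<delta>\<in>A. cis \<alpha> * herm (p \<gamma>) (p \<delta>))"
      by (simp add: v_eq herm_simps sum_distrib_left)
    also have "\<dots> = cis \<alpha> * herm (p \<gamma>) (p \<gamma>)" by (rule pick[OF p])
    finally have 1: "herm (p \<gamma>) (cis \<alpha> *s v) = cis \<alpha> * of_real (p \<gamma> \<bullet> p \<gamma>)" by (simp add: herm_self)
    have "herm (p \<gamma>) (cis \<alpha> *s v) = (\<Sum>\<delta>\<in>A. cis \<delta> * herm (p \<gamma>) (q \<delta>))"
      by (simp add: cv_eq r_eq herm_simps)
    also have "\<dots> = cis \<gamma> * herm (p \<gamma>) (q \<gamma>)" by (rule pick[OF q])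
    finally have "cis \<alpha> * of_real (p \<gamma> \<bullet> p \<gamma>) = cis \<gamma> * of_real (p \<gamma> \<bullet> q \<gamma>)"
      using 1 lagrangian_herm[OF \<Lambda>0, of "p \<gamma>" "q \<gamma>"] V0_sub \<gamma>(1) p q by auto
    then have "cis (- \<gamma>) * (cis \<alpha> * of_real (p \<gamma> \<bullet> p \<gamma>)) = of_real (p \<gamma> \<bullet> q \<gamma>)"
      by (simp add: mult.assoc[symmetric] cis_mult)
    then have "cis (\<alpha> - \<gamma>) * of_real (p \<gamma> \<bullet> p \<gamma>) = of_real (p \<gamma> \<bullet> q \<gamma>)"
      by (simp add: mult.assoc[symmetric] cis_mult)
    from arg_cong[OF this, of Im] have "sin (\<alpha> - \<gamma>) * (p \<gamma> \<bullet> p \<gamma>) = 0" by simp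
    moreover have "sin (\<alpha> - \<gamma>) \<noteq> 0"
    proof
      assume "sin (\<alpha> - \<gamma>) = 0"
      moreover have "\<bar>\<alpha> - \<gamma>\<bar> < pi" using \<alpha> A(2) \<gamma>(1) by (auto simp: abs_less_iff)
      ultimately have "\<alpha> - \<gamma> = 0" using sin_eq_0_pi[of "\<alpha> - \<gamma>"] by (auto simp: abs_less_iff)
      then show False using \<gamma>(2) by simp
    qed
    ultimately show ?thesis by simp
  qed
  show ?thesis
  proof (cases "\<alpha> \<in> A")
    case True
    have "v = (\<Sum>\<gamma>\<in>A. if \<gamma> = \<alpha> then p \<gamma> else 0)"
      unfolding v_eq by (intro sum.cong) (auto simp: p0)
    then have "v = p \<alpha>" using A(1) True by simp
    then show ?thesis using p True by simp
  next
    case False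
    then have "\<forall>\<gamma>\<in>A. p \<gamma> = 0" using p0 by blast
    then show ?thesis using False v_eq by simp
  qed
qed

lemma angle_decomposition_unique:
  assumes \<Lambda>0: "lagrangian \<Lambda>0" and dec: "angle_decomposition \<Lambda>0 \<Lambda>1 A V0 V1"
  shows "A = {\<alpha> \<in> {0..<pi}. \<not> angle_space \<Lambda>0 \<Lambda>1 \<alpha> \<subseteq> {0}}"
    and "\<And>\<alpha>. \<alpha> \<in> A \<Longrightarrow> V0 \<alpha> = angle_space \<Lambda>0 \<Lambda>1 \<alpha>"
proof -
  have A: "A \<subseteq> {0..<pi}" using dec by (simp add: angle_decomposition_def)
  show eq: "V0 \<alpha> = angle_space \<Lambda>0 \<Lambda>1 \<alpha>" if "\<alpha> \<in> A" for \<alpha>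
    using angle_decomposition_subset[OF dec that] angle_space_cases[OF \<Lambda>0 dec, of \<alpha>] A that by auto
  have "\<not> V0 \<alpha> \<subseteq> {0}" if "\<alpha> \<in> A" for \<alpha>
  proof -
    have "subspace (V0 \<alpha>)" "V0 \<alpha> \<noteq> {0}"
      using dec that by (auto simp: angle_decomposition_def orthogonal_decomposition_def)
    then show ?thesis using subspace_0 by auto
  qed
  moreover have "angle_space \<Lambda>0 \<Lambda>1 \<alpha> \<subseteq> {0}" if "\<alpha> \<in> {0..<pi}" "\<alpha> \<notin> A" for \<alpha>
    using angle_space_cases[OF \<Lambda>0 dec that(1)] that(2) by auto
  ultimately show "A = {\<alpha> \<in> {0..<pi}. \<not> angle_space \<Lambda>0 \<Lambda>1 \<alpha> \<subseteq> {0}}"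
    using A eq by blast
qed

lemma frame_angle_decomposition:
  fixes u :: "'n \<Rightarrow> complex^'n"
  assumes u: "unitary_frame u" and \<beta>: "\<And>j. \<beta> j \<in> {0..<pi}"
  defines "V \<equiv> (\<lambda>\<alpha>. span (u ` {j. \<beta> j = \<alpha>}))"
  shows "angle_decomposition (range (frame_map u)) (range (frame_map (\<lambda>j. cis (\<beta> j) *s u j)))
      (range \<beta>) V (\<lambda>\<alpha>. (\<lambda>v. cis \<alpha> *s v) ` V \<alpha>)"
    and "(\<Sum>\<alpha>\<in>range \<beta>. real (dim (V \<alpha>)) * \<alpha>) = (\<Sum>j\<in>UNIV. \<beta> j)"
proof -
  have lin: "linear (\<lambda>v. cis \<alpha> *s v :: complex^'n)" for \<alpha>
    by (rule linearI) (simp_all add: vec.scale_right_distrib vec_eq_iff scaleR_conv_of_real[where 'a=complex])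
  have frame_span: "range (frame_map e) = span (range e)" for e :: "'n \<Rightarrow> complex^'n"
  proof
    have "frame_map e x \<in> span (range e)" for x
      unfolding frame_map_def by (intro span_sum span_scale span_base rangeI)
    then show "range (frame_map e) \<subseteq> span (range e)" by blast
    have "e k \<in> range (frame_map e)" for k
      using frame_map_axis[of e k] by (metis rangeI)
    then show "span (range e) \<subseteq> range (frame_map e)"
      by (intro span_minimal linear_subspace_image linear_frame_map) auto
  qed
  have sub: "subspace (V \<alpha>)" for \<alpha> by (simp add: V_def)
  have uV: "u j \<in> V (\<beta> j)" for j by (auto simp: V_def intro: span_base)
  have u0: "u j \<noteq> 0" for j using unitary_frameD[OF u, of j j] by auto
  have herm0: "herm x y = 0" if "x \<in> V \<alpha>" "y \<in> V \<gamma>" "\<alpha> \<noteq> \<gamma>" for x y \<alpha> \<gamma>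
  proof -
    have 1: "herm (u k) y = 0" if "y \<in> V \<gamma>" "\<beta> k \<noteq> \<gamma>" for k y \<gamma>
      using that(1) unfolding V_def
    proof (induction rule: span_induct_alt)
      case (step c x y)
      then have "herm (u k) x = 0" using that(2) unitary_frameD[OF u, of k] by auto
      with step show ?case by (simp add: herm_simps)
    qed simp
    show ?thesis
      using that(1) unfolding V_def
    proof (induction rule: span_induct_alt)
      case (step c x z)
      then have "herm x y = 0" using 1[OF that(2)] that(3) by auto
      with step show ?case by (simp add: herm_simps)
    qed simp
  qed
  have span0: "span (\<Union>\<alpha>\<in>range \<beta>. V \<alpha>) = span (range u)"
  proof
    show "span (\<Union>\<alpha>\<in>range \<beta>. V \<alpha>) \<subseteq> span (range u)"
      unfolding V_def by (intro span_minimal subspace_span UN_least span_mono) auto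
    show "span (range u) \<subseteq> span (\<Union>\<alpha>\<in>range \<beta>. V \<alpha>)"
      using uV by (intro span_mono) blast
  qed
  have span1: "span (\<Union>\<alpha>\<in>range \<beta>. (\<lambda>v. cis \<alpha> *s v) ` V \<alpha>) = span (range (\<lambda>j. cis (\<beta> j) *s u j))"
  proof
    have "(\<lambda>v. cis \<alpha> *s v) ` V \<alpha> \<subseteq> span (range (\<lambda>j. cis (\<beta> j) *s u j))" for \<alpha>
      unfolding V_def linear_span_image[OF lin, symmetric] by (intro span_mono) auto
    then show "span (\<Union>\<alpha>\<in>range \<beta>. (\<lambda>v. cis \<alpha> *s v) ` V \<alpha>) \<subseteq> span (range (\<lambda>j. cis (\<beta> j) *s u j))"
      by (intro span_minimal subspace_span UN_least)
    show "span (range (\<lambda>j. cis (\<beta> j) *s u j)) \<subseteq> span (\<Union>\<alpha>\<in>range \<beta>. (\<lambda>v. cis \<alpha> *s v) ` V \<alpha>)"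
      using uV by (intro span_mono) blast
  qed
  have ne: "V (\<beta> j) \<noteq> {0}" for j using uV[of j] u0[of j] by blast
  have ne1: "(\<lambda>v. cis (\<beta> j) *s v) ` V (\<beta> j) \<noteq> {0}" for j
  proof -
    have "cis (\<beta> j) *s u j \<noteq> 0" using u0[of j] by (simp add: vec.scale_eq_0_iff)
    then show ?thesis using uV[of j] by blast
  qed
  have orth: "orthogonal x y" if "x \<in> V \<alpha>" "y \<in> V \<gamma>" "\<alpha> \<noteq> \<gamma>" for x y \<alpha> \<gamma>
    using herm0[OF that] Re_herm[of x y] by (simp add: orthogonal_def)
  have orth1: "orthogonal (cis \<alpha> *s x) (cis \<gamma> *s y)" if "x \<in> V \<alpha>" "y \<in> V \<gamma>" "\<alpha> \<noteq> \<gamma>" for x y \<alpha> \<gamma>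
    using herm0[OF that] Re_herm[of "cis \<alpha> *s x" "cis \<gamma> *s y"] by (simp add: orthogonal_def herm_simps)
  have "orthogonal_decomposition (range (frame_map u)) (range \<beta>) V"
    unfolding orthogonal_decomposition_def frame_span span0 using sub ne orth by blast
  moreover have "orthogonal_decomposition (range (frame_map (\<lambda>j. cis (\<beta> j) *s u j))) (range \<beta>)
      (\<lambda>\<alpha>. (\<lambda>v. cis \<alpha> *s v) ` V \<alpha>)"
    unfolding orthogonal_decomposition_def frame_span span1
    using linear_subspace_image[OF lin sub] ne1 orth1 by blast
  ultimately show "angle_decomposition (range (frame_map u)) (range (frame_map (\<lambda>j. cis (\<beta> j) *s u j)))
      (range \<beta>) V (\<lambda>\<alpha>. (\<lambda>v. cis \<alpha> *s v) ` V \<alpha>)"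
    using \<beta> by (auto simp: angle_decomposition_def)
  have dimV: "dim (V \<alpha>) = card {j. \<beta> j = \<alpha>}" for \<alpha>
  proof -
    have inj: "inj u"
      using unitary_frameD[OF u] by (metis injI zero_neq_one)
    have "pairwise orthogonal (u ` {j. \<beta> j = \<alpha>})"
    proof -
      have "u j \<bullet> u k = 0" if "u j \<noteq> u k" for j k
        using unitary_frameD[OF u, of j k] Re_herm[of "u j" "u k"] that by (cases "j = k") simp_all
      then show ?thesis by (auto simp: pairwise_def orthogonal_def)
    qed
    then have "independent (u ` {j. \<beta> j = \<alpha>})"
      using u0 by (intro pairwise_orthogonal_independent) auto
    then have "dim (V \<alpha>) = card (u ` {j. \<beta> j = \<alpha>})"
      by (simp add: V_def dim_eq_card_independent)
    then show ?thesis using inj by (simp add: card_image inj_on_subset)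
  qed
  have "(\<Sum>j\<in>UNIV. \<beta> j) = (\<Sum>\<alpha>\<in>range \<beta>. \<Sum>j | j \<in> UNIV \<and> \<beta> j = \<alpha>. \<beta> j)"
    by (rule sum.image_gen) simp
  also have "\<dots> = (\<Sum>\<alpha>\<in>range \<beta>. real (dim (V \<alpha>)) * \<alpha>)"
    by (intro sum.cong) (simp_all add: dimV)
  finally show "(\<Sum>\<alpha>\<in>range \<beta>. real (dim (V \<alpha>)) * \<alpha>) = (\<Sum>j\<in>UNIV. \<beta> j)" by simp
qed

text \<open>The frame yields one angle decomposition, with the eigenspaces of equal angle as summands;
  uniqueness turns its value into the value of the definite description in \<^const>\<open>maslov_index\<close>.\<close>

lemma maslov_index_frame:
  fixes u :: "'n \<Rightarrow> complex^'n"
  assumes u: "unitary_frame u" and \<beta>: "\<And>j. \<beta> j \<in> {0..<pi}"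
    and \<Lambda>0: "range (frame_map u) = \<Lambda>0" and \<Lambda>1: "range (frame_map (\<lambda>j. cis (\<beta> j) *s u j)) = \<Lambda>1"
  shows "maslov_index \<Lambda>0 \<Lambda>1 = 1 / pi * ((\<Sum>j\<in>UNIV. \<beta> j) + phase \<Lambda>0 - phase \<Lambda>1)"
proof -
  obtain V0 V1 where dec: "angle_decomposition \<Lambda>0 \<Lambda>1 (range \<beta>) V0 V1"
    and sum: "(\<Sum>\<alpha>\<in>range \<beta>. real (dim (V0 \<alpha>)) * \<alpha>) = (\<Sum>j\<in>UNIV. \<beta> j)"
    using frame_angle_decomposition[where \<beta> = \<beta>, OF u \<beta>] unfolding \<Lambda>0 \<Lambda>1 by (rule that)
  have lag: "lagrangian \<Lambda>0" using lagrangian_range_frame_map[OF u] \<Lambda>0 by simp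
  show ?thesis
    unfolding maslov_index_def
  proof (rule the_equality)
    show "\<exists>A V0 V1. angle_decomposition \<Lambda>0 \<Lambda>1 A V0 V1
       \<and> 1 / pi * ((\<Sum>j\<in>UNIV. \<beta> j) + phase \<Lambda>0 - phase \<Lambda>1)
         = 1 / pi * ((\<Sum>\<alpha>\<in>A. real (dim (V0 \<alpha>)) * \<alpha>) + phase \<Lambda>0 - phase \<Lambda>1)"
      using dec sum by force
    fix m assume "\<exists>A V0 V1. angle_decomposition \<Lambda>0 \<Lambda>1 A V0 V1
       \<and> m = 1 / pi * ((\<Sum>\<alpha>\<in>A. real (dim (V0 \<alpha>)) * \<alpha>) + phase \<Lambda>0 - phase \<Lambda>1)"
    then obtain A W0 W1 where dec': "angle_decomposition \<Lambda>0 \<Lambda>1 A W0 W1"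
      and m: "m = 1 / pi * ((\<Sum>\<alpha>\<in>A. real (dim (W0 \<alpha>)) * \<alpha>) + phase \<Lambda>0 - phase \<Lambda>1)" by blast
    have A: "A = range \<beta>"
      using angle_decomposition_unique(1)[OF lag dec'] angle_decomposition_unique(1)[OF lag dec] by simp
    have "W0 \<alpha> = V0 \<alpha>" if "\<alpha> \<in> A" for \<alpha>
      using angle_decomposition_unique(2)[OF lag dec', of \<alpha>] angle_decomposition_unique(2)[OF lag dec, of \<alpha>]
        that A by simp
    then have "(\<Sum>\<alpha>\<in>A. real (dim (W0 \<alpha>)) * \<alpha>) = (\<Sum>j\<in>UNIV. \<beta> j)"
      using sum A by (metis (mono_tags, lifting) sum.cong)
    then show "m = 1 / pi * ((\<Sum>j\<in>UNIV. \<beta> j) + phase \<Lambda>0 - phase \<Lambda>1)" using m by simp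
  qed
qed

section \<open>Scalar autonomous differential equations\<close>

text \<open>Separation of variables: the travel time \<open>\<tau>\<close> is an integral of \<open>1/f\<close>, and the
  solution is its inverse function. The factor \<open>T\<close>, the total travel time, normalizes the time
  interval to \<open>[0,1]\<close>.\<close>

lemma autonomous_ode_connects:
  fixes f :: "real \<Rightarrow> real"
  assumes "a < b" and cont: "continuous_on {a..b} f" and pos: "\<And>x. x \<in> {a..b} \<Longrightarrow> 0 < f x"
  obtains T y where "T > 0" "y 0 = a" "y 1 = b"
    "\<And>t. t \<in> {0..1} \<Longrightarrow> y t \<in> {a..b}"
    "\<And>t. t \<in> {0..1} \<Longrightarrow> (y has_real_derivative T * f (y t)) (at t within {0..1})"
proof -
  \<comment> \<open>Extending \<open>1/f\<close> by constants beyond the interval turns the one-sided derivatives at its end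
    points into two-sided ones, as needed for inverting \<open>\<tau>\<close>.\<close>
  define g where "g x = inverse (f (max a (min b x)))" for x
  have in_ab: "max a (min b x) \<in> {a..b}" for x using \<open>a < b\<close> by auto
  have gpos: "0 < g x" for x using pos[OF in_ab] by (simp add: g_def)
  have gcont: "continuous_on S g" for S
    unfolding g_def
  proof (intro continuous_intros continuous_on_compose2[OF cont])
    show "(\<lambda>x. max a (min b x)) ` S \<subseteq> {a..b}" using in_ab by blast
    show "\<forall>x\<in>S. f (max a (min b x)) \<noteq> 0" using pos[OF in_ab] by (metis less_irrefl)
  qed
  define \<tau> where "\<tau> x = integral {a - 1..x} g" for x
  have d\<tau>: "(\<tau> has_real_derivative g x) (at x within {a-1..b+1})" if "x \<in> {a-1..b+1}" for x
    unfolding \<tau>_def using integral_has_real_derivative[OF gcont that] .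
  have \<tau>cont: "continuous_on {a-1..b+1} \<tau>"
    using d\<tau> by (meson DERIV_continuous_on)
  have \<tau>at: "(\<tau> has_real_derivative g x) (at x)" if "a - 1 < x" "x < b + 1" for x
    using d\<tau>[of x] that by (simp add: at_within_Icc_at)
  have \<tau>mono: "\<tau> x < \<tau> y" if "a - 1 \<le> x" "x < y" "y \<le> b + 1" for x y
  proof (rule DERIV_pos_imp_increasing_open[OF \<open>x < y\<close>])
    show "\<exists>d. (\<tau> has_real_derivative d) (at z) \<and> d > 0" if "x < z" "z < y" for z
      using \<tau>at[of z] gpos[of z] that \<open>a - 1 \<le> x\<close> \<open>y \<le> b + 1\<close> by force
    show "continuous_on {x..y} \<tau>"
      using \<tau>cont by (rule continuous_on_subset) (use that in auto)
  qed
  have inj: "inj_on \<tau> {a-1..b+1}"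
    by (rule linorder_inj_onI) (use \<tau>mono in force, auto)
  define \<eta> where "\<eta> = inv_into {a-1..b+1} \<tau>"
  have \<eta>\<tau>: "\<eta> (\<tau> x) = x" if "x \<in> {a-1..b+1}" for x
    unfolding \<eta>_def using inv_into_f_f[OF inj that] .
  have onto: "\<exists>x\<in>{a-1..b+1}. \<tau> x = y" if "\<tau> (a-1) \<le> y" "y \<le> \<tau> (b+1)" for y
    using IVT'[OF that _ \<tau>cont] \<open>a < b\<close> by (metis add_increasing2 atLeastAtMost_iff diff_le_eq less_imp_le zero_le_one)
  have \<tau>\<eta>: "\<tau> (\<eta> y) = y" if "\<tau> (a-1) < y" "y < \<tau> (b+1)" for y
    using onto[of y] that \<eta>\<tau> by (metis less_imp_le)
  have \<eta>d: "(\<eta> has_real_derivative f x) (at (\<tau> x))" if x: "x \<in> {a..b}" for x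
  proof -
    have x': "a - 1 < x" "x < b + 1" using x by auto
    have "isCont \<eta> (\<tau> x)"
    proof (rule isCont_inverse_function[where f=\<tau> and x=x and d="1/2"])
      show "\<eta> (\<tau> z) = z" if "\<bar>z - x\<bar> \<le> 1/2" for z
        by (rule \<eta>\<tau>) (use that x in \<open>simp add: abs_le_iff; linarith\<close>)
      show "isCont \<tau> z" if "\<bar>z - x\<bar> \<le> 1/2" for z
        by (rule DERIV_isCont[OF \<tau>at]; use that x in \<open>simp add: abs_le_iff; linarith\<close>)
    qed auto
    then have "(\<eta> has_real_derivative inverse (g x)) (at (\<tau> x))"
    proof (intro DERIV_inverse_function[where a="\<tau> (a-1)" and b="\<tau> (b+1)" and f=\<tau>])
      show "(\<tau> has_real_derivative g x) (at (\<eta> (\<tau> x)))"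
        using \<tau>at[OF x'] \<eta>\<tau>[of x] x' by simp
    qed (use gpos[of x] \<tau>\<eta> \<tau>mono x' in \<open>auto\<close>)
    moreover have "inverse (g x) = f x" using x by (simp add: g_def)
    ultimately show ?thesis by simp
  qed
  define T where "T = \<tau> b - \<tau> a"
  define y where "y t = \<eta> (\<tau> a + t * T)" for t
  have T: "T > 0" using \<tau>mono[of a b] \<open>a < b\<close> by (simp add: T_def)
  have img: "\<exists>x\<in>{a..b}. \<tau> x = \<tau> a + t * T" if "t \<in> {0..1}" for t
  proof -
    have "0 \<le> t * T" "t * T \<le> T" using that T mult_right_mono[of t 1 T] by auto
    then have "\<tau> a \<le> \<tau> a + t * T" "\<tau> a + t * T \<le> \<tau> b" unfolding T_def by linarith+
    moreover have "continuous_on {a..b} \<tau>"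
      using \<tau>cont by (rule continuous_on_subset) auto
    ultimately obtain x where "a \<le> x" "x \<le> b" "\<tau> x = \<tau> a + t * T"
      using IVT'[of \<tau> a "\<tau> a + t * T" b] \<open>a < b\<close> by (metis less_imp_le)
    then show ?thesis by auto
  qed
  show ?thesis
  proof (rule that[OF T])
    show "y 0 = a" "y 1 = b" using \<eta>\<tau>[of a] \<eta>\<tau>[of b] \<open>a < b\<close> by (auto simp: y_def T_def)
    fix t :: real assume t: "t \<in> {0..1}"
    obtain x where x: "x \<in> {a..b}" "\<tau> x = \<tau> a + t * T" using img[OF t] by blast
    have yt: "y t = x" using \<eta>\<tau>[of x] x by (simp add: y_def)
    show "y t \<in> {a..b}" using yt x by simp
    have "((\<lambda>t. \<eta> (\<tau> a + t * T)) has_real_derivative f x * T) (at t within {0..1})"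
      by (rule DERIV_chain2[of \<eta>]) (use \<eta>d[OF x(1)] x in \<open>auto intro!: derivative_eq_intros\<close>)
    then have "(y has_real_derivative f x * T) (at t within {0..1})"
      unfolding y_def[abs_def] .
    then show "(y has_real_derivative T * f (y t)) (at t within {0..1})"
      by (simp add: yt mult.commute)
  qed
qed

section \<open>Maps of the simplex that preserve faces\<close>

definition prob_simplex :: "(real^'n) set" where
  "prob_simplex = {c. (\<forall>k. 0 \<le> c $ k) \<and> (\<Sum>k\<in>UNIV. c $ k) = 1}"

lemma prob_simplex_D:
  assumes "c \<in> prob_simplex"
  shows "0 \<le> c $ k" "(\<Sum>k\<in>UNIV. c $ k) = 1" "c $ k \<le> 1"
proof -
  show 0: "0 \<le> c $ k" for k using assms by (simp add: prob_simplex_def)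
  show 1: "(\<Sum>k\<in>UNIV. c $ k) = 1" using assms by (simp add: prob_simplex_def)
  show "c $ k \<le> 1" using member_le_sum[of k UNIV "($) c"] 0 1 by simp
qed

lemma prob_simplex_pos_coord:
  assumes "c \<in> prob_simplex"
  obtains k where "0 < c $ k"
proof -
  have "\<exists>k. c $ k \<noteq> 0"
    using prob_simplex_D(2)[OF assms] by (metis sum.neutral zero_neq_one)
  then show ?thesis using that prob_simplex_D(1)[OF assms] by (metis less_eq_real_def)
qed

lemma compact_prob_simplex: "compact (prob_simplex :: (real^'n) set)"
proof -
  have "closed (prob_simplex :: (real^'n) set)"
    unfolding prob_simplex_def
    by (intro closed_Collect_conj closed_Collect_all closed_Collect_le closed_Collect_eq continuous_intros)
  moreover have "(prob_simplex :: (real^'n) set) \<subseteq> cbox 0 1"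
    using prob_simplex_D by (auto simp: mem_box_cart)
  ultimately show ?thesis
    using bounded_cbox bounded_subset compact_eq_bounded_closed by blast
qed

lemma convex_prob_simplex: "convex (prob_simplex :: (real^'n) set)"
  by (auto simp: convex_def prob_simplex_def sum.distrib sum_distrib_left[symmetric])

lemma prob_simplex_nonempty: "(prob_simplex :: (real^'n) set) \<noteq> {}"
proof -
  have "(\<chi> k. 1 / CARD('n)) \<in> (prob_simplex :: (real^'n) set)"
    by (simp add: prob_simplex_def)
  then show ?thesis by blast
qed

text \<open>Brouwer's theorem is applied to a map \<open>N\<close> as in Nash's proof of the existence of equilibria: it
  moves weight towards the coordinates where \<open>B c\<close> falls short of \<open>b\<close>. At a fixed point with a
  positive total shortage, exactly the coordinates in the support of \<open>c\<close> fall short, while off the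
  support \<open>B c\<close> vanishes and hence does not exceed \<open>b\<close>; this contradicts the equality of the sums.\<close>

lemma face_preserving_map_onto:
  fixes B :: "real^'n \<Rightarrow> real^'n"
  assumes cont: "continuous_on prob_simplex B"
    and total: "\<And>c. c \<in> prob_simplex \<Longrightarrow> (\<Sum>k\<in>UNIV. B c $ k) = (\<Sum>k\<in>UNIV. b $ k)"
    and face: "\<And>c k. c \<in> prob_simplex \<Longrightarrow> c $ k = 0 \<Longrightarrow> B c $ k = 0"
    and b: "\<And>k. 0 \<le> b $ k"
  obtains c where "c \<in> prob_simplex" "B c = b"
proof -
  define e where "e c k = max 0 (b $ k - B c $ k)" for c k
  define s where "s c = (\<Sum>k\<in>UNIV. e c k)" for c
  define N where "N c = (\<chi> k. (c $ k + e c k) / (1 + s c))" for c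
  have e0: "0 \<le> e c k" for c k by (simp add: e_def)
  have s0: "0 \<le> s c" for c unfolding s_def by (simp add: sum_nonneg e0)
  have "continuous_on prob_simplex N"
  proof -
    have "1 + s c \<noteq> 0" for c using s0[of c] by simp
    then show ?thesis
      unfolding N_def e_def s_def by (intro continuous_intros cont) blast
  qed
  moreover have "N \<in> prob_simplex \<rightarrow> prob_simplex"
  proof
    fix c :: "real^'n" assume c: "c \<in> prob_simplex"
    have "(\<Sum>k\<in>UNIV. (c $ k + e c k) / (1 + s c)) = (1 + s c) / (1 + s c)"
      using prob_simplex_D[OF c] by (simp add: sum_divide_distrib[symmetric] sum.distrib s_def)
    also have "\<dots> = 1" using s0[of c] by simp
    finally show "N c \<in> prob_simplex"
      using prob_simplex_D[OF c] e0 s0 by (simp add: prob_simplex_def N_def)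
  qed
  ultimately obtain c where c: "c \<in> prob_simplex" and fp: "N c = c"
    using brouwer[OF compact_prob_simplex convex_prob_simplex prob_simplex_nonempty] by blast
  have ck: "c $ k * s c = e c k" for k
  proof -
    have "c $ k = (c $ k + e c k) / (1 + s c)" using fp by (metis N_def vec_lambda_beta)
    moreover have "1 + s c > 0" using s0[of c] by simp
    ultimately show ?thesis by (simp add: field_simps)
  qed
  have "s c = 0"
  proof (rule ccontr)
    assume "s c \<noteq> 0"
    then have sp: "s c > 0" using s0[of c] by simp
    have le: "B c $ k \<le> b $ k" for k
    proof (cases "c $ k = 0")
      case True then show ?thesis using face[OF c] b by simp
    next
      case False
      then have "c $ k > 0" using prob_simplex_D(1)[OF c, of k] by simp
      then have "e c k > 0" using ck[of k] sp by (metis mult_pos_pos)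
      then show ?thesis by (simp add: e_def)
    qed
    have "\<exists>k. e c k > 0" using sp unfolding s_def
      by (meson e0 less_le_not_le sum_nonpos linorder_not_le)
    then obtain k where "e c k > 0" by blast
    then have "B c $ k < b $ k" by (simp add: e_def)
    then have "(\<Sum>k\<in>UNIV. B c $ k) < (\<Sum>k\<in>UNIV. b $ k)"
      using le by (intro sum_strict_mono_ex1) auto
    then show False using total[OF c] by simp
  qed
  then have "e c k = 0" for k using ck[of k] by simp
  then have le: "b $ k \<le> B c $ k" for k unfolding e_def by (smt (verit))
  have "b $ k = B c $ k" for k
  proof (rule ccontr)
    assume "b $ k \<noteq> B c $ k"
    then have "b $ k < B c $ k" using le[of k] by simp
    then have "(\<Sum>k\<in>UNIV. b $ k) < (\<Sum>k\<in>UNIV. B c $ k)"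
      using le by (intro sum_strict_mono_ex1) auto
    then show False using total[OF c] by simp
  qed
  then show ?thesis using that[OF c] by (simp add: vec_eq_iff)
qed

section \<open>The squared radii as functions of the phase\<close>

text \<open>Along a solution of the neck equations the squared radii are \<open>1 + c\<^sub>k s\<close>, and their product
  \<open>p\<close> is prescribed by the phase. So \<open>s\<close> is defined as a function of \<open>c\<close> and \<open>p\<close>; it is unique since
  the product increases strictly in \<open>s\<close> as long as all factors are positive.\<close>

definition neck_param :: "real^'n \<Rightarrow> real \<Rightarrow> real" where
  "neck_param c p = (THE s. (\<forall>k. 0 < 1 + c $ k * s) \<and> (\<Prod>k\<in>UNIV. 1 + c $ k * s) = p)"

lemma neck_prod_strict_mono:
  fixes c :: "real^'n"
  assumes c: "c \<in> prob_simplex" and "s < t" and s: "\<And>k. 0 < 1 + c $ k * s"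
  shows "(\<Prod>k\<in>UNIV. 1 + c $ k * s) < (\<Prod>k\<in>UNIV. 1 + c $ k * t)"
proof -
  have le: "1 + c $ k * s \<le> 1 + c $ k * t" for k
    using prob_simplex_D(1)[OF c, of k] \<open>s < t\<close> by (simp add: mult_left_mono)
  have t: "0 < 1 + c $ k * t" for k using s[of k] le[of k] by linarith
  obtain k where "c $ k > 0" by (rule prob_simplex_pos_coord[OF c])
  then have k: "1 + c $ k * s < 1 + c $ k * t" using \<open>s < t\<close> by simp
  have "(\<Sum>k\<in>UNIV. ln (1 + c $ k * s)) < (\<Sum>k\<in>UNIV. ln (1 + c $ k * t))"
    using le s t k by (intro sum_strict_mono_ex1) (auto intro!: bexI[of _ k])
  then have "ln (\<Prod>k\<in>UNIV. 1 + c $ k * s) < ln (\<Prod>k\<in>UNIV. 1 + c $ k * t)"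
    using s t by (simp add: ln_prod less_imp_neq[OF s, symmetric] less_imp_neq[OF t, symmetric])
  then show ?thesis using s t by (simp add: prod_pos)
qed

text \<open>The product vanishes at \<open>s = -1/m\<close>, where \<open>m\<close> is the largest coordinate of \<open>c\<close>, and it is at
  least \<open>p\<close> at \<open>s = p\<close>.\<close>

lemma neck_prod_exists:
  fixes c :: "real^'n"
  assumes c: "c \<in> prob_simplex" and "0 < p"
  shows "\<exists>s. (\<forall>k. 0 < 1 + c $ k * s) \<and> (\<Prod>k\<in>UNIV. 1 + c $ k * s) = p"
proof -
  define m where "m = Max (range (($) c))"
  have m_ge: "c $ k \<le> m" for k unfolding m_def by simp
  have "m \<in> range (($) c)" unfolding m_def by (rule Max_in) auto
  then obtain j where j: "c $ j = m" by blast
  obtain i where "c $ i > 0" by (rule prob_simplex_pos_coord[OF c])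
  then have m: "m > 0" using m_ge[of i] by simp
  have low: "0 \<le> 1 + c $ k * s" if "-1/m \<le> s" for k s
  proof -
    have "c $ k * (-1/m) \<le> c $ k * s" using that prob_simplex_D(1)[OF c] by (intro mult_left_mono) auto
    moreover have "c $ k / m \<le> 1" using m m_ge by simp
    ultimately show ?thesis by simp
  qed
  have "(\<Prod>k\<in>UNIV. 1 + c $ k * (-1/m)) = 0" using j m by (intro prod_zero) auto
  then have "(\<Prod>k\<in>UNIV. 1 + c $ k * (-1/m)) \<le> p" using \<open>0 < p\<close> by linarith
  moreover have "p \<le> (\<Prod>k\<in>UNIV. 1 + c $ k * p)"
  proof -
    have "p = (\<Sum>k\<in>UNIV. c $ k * p)" using prob_simplex_D(2)[OF c] by (simp add: sum_distrib_right[symmetric])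
    also have "\<dots> \<le> (\<Prod>k\<in>UNIV. 1 + c $ k * p)"
      by (rule sum_le_prod) (use prob_simplex_D(1)[OF c] \<open>0 < p\<close> in simp)
    finally show ?thesis .
  qed
  moreover have "-1/m \<le> p" using \<open>0 < p\<close> m by (intro order.trans[of "-1/m" 0 p]) auto
  moreover have "continuous_on {-1/m..p} (\<lambda>s. \<Prod>k\<in>UNIV. 1 + c $ k * s)"
    by (intro continuous_intros)
  ultimately have "\<exists>s\<ge>-1/m. s \<le> p \<and> (\<Prod>k\<in>UNIV. 1 + c $ k * s) = p"
    by (rule IVT')
  then obtain s where s: "s \<ge> -1/m" "(\<Prod>k\<in>UNIV. 1 + c $ k * s) = p" by blast
  have "1 + c $ k * s \<noteq> 0" for k
  proof
    assume "1 + c $ k * s = 0"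
    then have "(\<Prod>k\<in>UNIV. 1 + c $ k * s) = 0" by (intro prod_zero) auto
    then show False using s \<open>0 < p\<close> by simp
  qed
  then show ?thesis using s low by (metis less_eq_real_def)
qed

lemma neck_param:
  fixes c :: "real^'n"
  assumes c: "c \<in> prob_simplex" and "0 < p"
  shows "0 < 1 + c $ k * neck_param c p" "(\<Prod>k\<in>UNIV. 1 + c $ k * neck_param c p) = p"
    and neck_param_unique:
      "\<And>s. (\<And>k. 0 < 1 + c $ k * s) \<Longrightarrow> (\<Prod>k\<in>UNIV. 1 + c $ k * s) = p \<Longrightarrow> neck_param c p = s"
proof -
  let ?P = "\<lambda>s. (\<forall>k. 0 < 1 + c $ k * s) \<and> (\<Prod>k\<in>UNIV. 1 + c $ k * s) = p"
  have uniq: "s = t" if "?P s" "?P t" for s t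
    using neck_prod_strict_mono[OF c, of s t] neck_prod_strict_mono[OF c, of t s] that
    by (metis linorder_neqE_linordered_idom order_less_irrefl)
  have ex1: "\<exists>!s. ?P s" using neck_prod_exists[OF assms] uniq by blast
  have P: "?P (neck_param c p)" unfolding neck_param_def by (rule theI'[OF ex1])
  then show "0 < 1 + c $ k * neck_param c p" "(\<Prod>k\<in>UNIV. 1 + c $ k * neck_param c p) = p" by auto
  show "neck_param c p = s" if "\<And>k. 0 < 1 + c $ k * s" "(\<Prod>k\<in>UNIV. 1 + c $ k * s) = p" for s
    using uniq[OF P] that by blast
qed

text \<open>Compactness of the range is what the closed graph argument for continuity requires. The
  lower bound expresses that the sum of the factors is positive.\<close>

lemma neck_param_bounds:
  fixes c :: "real^'n"
  assumes c: "c \<in> prob_simplex" and "0 < p"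
  shows "- real CARD('n) \<le> neck_param c p" "neck_param c p \<le> p"
proof -
  let ?s = "neck_param c p"
  have "0 \<le> (\<Sum>k\<in>UNIV. 1 + c $ k * ?s)"
    by (intro sum_nonneg) (use neck_param(1)[OF assms] less_imp_le in blast)
  also have "\<dots> = real CARD('n) + ?s"
    using prob_simplex_D(2)[OF c] by (simp add: sum.distrib sum_distrib_right[symmetric])
  finally show "- real CARD('n) \<le> ?s" by simp
  show "?s \<le> p"
  proof (cases "0 \<le> ?s")
    case True
    have "?s = (\<Sum>k\<in>UNIV. c $ k * ?s)" using prob_simplex_D(2)[OF c] by (simp add: sum_distrib_right[symmetric])
    also have "\<dots> \<le> (\<Prod>k\<in>UNIV. 1 + c $ k * ?s)"
      by (rule sum_le_prod) (use prob_simplex_D(1)[OF c] True in simp)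
    finally show ?thesis using neck_param(2)[OF assms] by simp
  qed (use \<open>0 < p\<close> in simp)
qed

text \<open>In the equations of the graph, positivity of the factors may be weakened to nonnegativity
  because their product is positive anyway. So the graph is closed.\<close>

lemma continuous_on_neck_param:
  assumes "0 < p1"
  shows "continuous_on (prob_simplex \<times> {p1..p2}) (\<lambda>(c :: real^'n, p). neck_param c p)"
proof (rule continuous_from_closed_graph)
  let ?S = "prob_simplex \<times> {p1..p2} :: ((real^'n) \<times> real) set"
  let ?f = "\<lambda>(c :: real^'n, p). neck_param c p"
  show "compact {- real CARD('n)..p2}" by simp
  show "?f \<in> ?S \<rightarrow> {- real CARD('n)..p2}"
  proof
    fix x :: "(real^'n) \<times> real" assume "x \<in> ?S"
    then obtain c p where x: "x = (c, p)" and c: "c \<in> prob_simplex" and p: "p \<in> {p1..p2}" by auto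
    have "0 < p" using p assms by auto
    from neck_param_bounds[OF c this] show "?f x \<in> {- real CARD('n)..p2}" using p by (auto simp: x)
  qed
  have "(\<lambda>x. (x, ?f x)) ` ?S = (?S \<times> UNIV) \<inter>
     {z. (\<forall>k. 0 \<le> 1 + fst (fst z) $ k * snd z) \<and> (\<Prod>k\<in>UNIV. 1 + fst (fst z) $ k * snd z) = snd (fst z)}"
    (is "?G = ?H")
  proof
    show "?G \<subseteq> ?H"
    proof
      fix z assume "z \<in> ?G"
      then obtain c p where z: "z = ((c, p), neck_param c p)" and c: "c \<in> prob_simplex" and p: "p \<in> {p1..p2}" by auto
      have "0 < p" using p assms by auto
      from neck_param(1,2)[OF c this] show "z \<in> ?H" using c p by (auto simp: z less_imp_le)
    qed
    show "?H \<subseteq> ?G"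
    proof
      fix z assume z: "z \<in> ?H"
      obtain c p s where zz: "z = ((c, p), s)" by (metis prod.collapse)
      have c: "c \<in> prob_simplex" and p: "p \<in> {p1..p2}" and s: "\<And>k. 0 \<le> 1 + c $ k * s"
        and ps: "(\<Prod>k\<in>UNIV. 1 + c $ k * s) = p" using z by (auto simp: zz)
      have p0: "0 < p" using p assms by auto
      have "1 + c $ k * s \<noteq> 0" for k
      proof
        assume "1 + c $ k * s = 0"
        then have "(\<Prod>k\<in>UNIV. 1 + c $ k * s) = 0" by (intro prod_zero) auto
        then show False using ps p0 by simp
      qed
      then have "0 < 1 + c $ k * s" for k using s[of k] by (simp add: less_le)
      then have "neck_param c p = s" using neck_param_unique[OF c p0] ps by blast
      then show "z \<in> ?G" using c p by (force simp: zz)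
    qed
  qed
  moreover have "closed ?H"
    by (intro closed_Int closed_Times compact_imp_closed[OF compact_prob_simplex] closed_atLeastAtMost closed_UNIV
        closed_Collect_conj closed_Collect_all closed_Collect_le closed_Collect_eq continuous_intros)
  ultimately show "closed ((\<lambda>x. (x, ?f x)) ` ?S)" by simp
qed

lemma neck_param_has_derivative:
  fixes c :: "real^'n"
  assumes c: "c \<in> prob_simplex" and p: "0 < p"
  defines "s \<equiv> neck_param c p"
  shows "(neck_param c has_real_derivative inverse (p * (\<Sum>k\<in>UNIV. c $ k / (1 + c $ k * s)))) (at p)"
    and "0 < (\<Sum>k\<in>UNIV. c $ k / (1 + c $ k * s))"
proof -
  have pos: "0 < 1 + c $ k * s" for k unfolding s_def by (rule neck_param(1)[OF c p])
  obtain k where "c $ k > 0" by (rule prob_simplex_pos_coord[OF c])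
  then show q: "0 < (\<Sum>k\<in>UNIV. c $ k / (1 + c $ k * s))"
    using prob_simplex_D(1)[OF c] pos
    by (intro sum_pos2[of _ k]) (auto simp: less_imp_le)
  have "((\<lambda>s. \<Prod>k\<in>UNIV. 1 + c $ k * s) has_real_derivative
      (\<Prod>k\<in>UNIV. 1 + c $ k * s) * (\<Sum>k\<in>UNIV. c $ k / (1 + c $ k * s))) (at s)"
    by (rule has_field_derivative_prod')
       (use less_imp_neq[OF pos] in \<open>auto intro!: derivative_eq_intros\<close>)
  then have D: "((\<lambda>s. \<Prod>k\<in>UNIV. 1 + c $ k * s) has_real_derivative
      p * (\<Sum>k\<in>UNIV. c $ k / (1 + c $ k * s))) (at (neck_param c p))"
    using neck_param(2)[OF c p] by (simp add: s_def)
  have "continuous_on (prob_simplex \<times> {p/2..p+1}) (\<lambda>(c :: real^'n, p). neck_param c p)"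
    by (rule continuous_on_neck_param) (use p in simp)
  then have "continuous_on {p/2..p+1} (\<lambda>q. (\<lambda>(c :: real^'n, p). neck_param c p) (c, q))"
    by (rule continuous_on_compose2) (use c in \<open>auto intro!: continuous_intros\<close>)
  then have "continuous_on {p/2..p+1} (neck_param c)" by simp
  then have "isCont (neck_param c) p"
    by (rule continuous_on_interior) (use p in simp)
  then show "(neck_param c has_real_derivative inverse (p * (\<Sum>k\<in>UNIV. c $ k / (1 + c $ k * s)))) (at p)"
    by (intro DERIV_inverse_function[where a=0 and b="p+1" and g="neck_param c", OF D])
       (use p q neck_param(2)[OF c] in auto)
qed

section \<open>The neck equations\<close>

text \<open>The neck equations with the phase \<open>\<theta>\<close> as independent variable. By the conservation
  law, the product of the squared radii is \<open>p \<theta> = (cos \<theta>0 / cos \<theta>)\<^sup>2\<close>. The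
  integrals in the last clause are the increments of the angles; the phase interval is fixed by the sum of
  the prescribed increments, and only their distribution depends on \<open>c\<close>.\<close>

lemma prescribed_angle_increments:
  fixes \<beta> :: "real^'n"
  assumes \<beta>: "\<And>k. 0 \<le> \<beta> $ k" and "\<theta>0 < \<theta>1" and \<theta>0: "-pi/2 < \<theta>0" and \<theta>1: "\<theta>1 < pi/2"
    and sum\<beta>: "(\<Sum>k\<in>UNIV. \<beta> $ k) = \<theta>1 - \<theta>0"
  obtains c :: "real^'n" and s :: "real \<Rightarrow> real"
  where "c \<in> prob_simplex"
    "\<And>k. c $ k = 0 \<Longrightarrow> \<beta> $ k = 0"
    "\<And>\<theta> k. \<theta> \<in> {\<theta>0..\<theta>1} \<Longrightarrow> 0 < 1 + c $ k * s \<theta>"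
    "\<And>\<theta>. \<theta> \<in> {\<theta>0..\<theta>1} \<Longrightarrow> (s has_real_derivative 2 * tan \<theta> / (\<Sum>l\<in>UNIV. c $ l / (1 + c $ l * s \<theta>))) (at \<theta>)"
    "\<And>k. integral {\<theta>0..\<theta>1} (\<lambda>\<theta>. (c $ k / (1 + c $ k * s \<theta>)) / (\<Sum>l\<in>UNIV. c $ l / (1 + c $ l * s \<theta>))) = \<beta> $ k"
proof -
  define p where "p \<theta> = (cos \<theta>0 / cos \<theta>)\<^sup>2" for \<theta>
  define q where "q c k \<theta> = c $ k / (1 + c $ k * neck_param c (p \<theta>))" for c :: "real^'n" and k \<theta>
  define w where "w c k \<theta> = q c k \<theta> / (\<Sum>l\<in>UNIV. q c l \<theta>)" for c k \<theta>
  let ?I = "{\<theta>0..\<theta>1}"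
  let ?\<Delta> = "prob_simplex :: (real^'n) set"
  have cos_pos: "0 < cos \<theta>" if "\<theta> \<in> ?I" for \<theta>
    using that \<theta>0 \<theta>1 by (intro cos_gt_zero_pi) auto
  have cos0: "0 < cos \<theta>0" using cos_pos[of \<theta>0] \<open>\<theta>0 < \<theta>1\<close> by simp
  have p_pos: "0 < p \<theta>" if "\<theta> \<in> ?I" for \<theta> using cos_pos[OF that] cos0 by (simp add: p_def)
  have p_cont: "continuous_on ?I p"
    unfolding p_def by (intro continuous_intros) (use cos_pos in force)
  have I_ne: "?I \<noteq> {}" using \<open>\<theta>0 < \<theta>1\<close> by simp
  obtain m where m: "m \<in> ?I" "\<And>\<theta>. \<theta> \<in> ?I \<Longrightarrow> p m \<le> p \<theta>"
    using continuous_attains_inf[OF compact_Icc I_ne p_cont] by blast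
  obtain M where M: "M \<in> ?I" "\<And>\<theta>. \<theta> \<in> ?I \<Longrightarrow> p \<theta> \<le> p M"
    using continuous_attains_sup[OF compact_Icc I_ne p_cont] by blast
  have rho_pos: "0 < 1 + c $ k * neck_param c (p \<theta>)" if "c \<in> ?\<Delta>" "\<theta> \<in> ?I" for c k \<theta>
    using neck_param(1)[OF that(1) p_pos[OF that(2)]] .
  have Q_pos: "0 < (\<Sum>l\<in>UNIV. q c l \<theta>)" if "c \<in> ?\<Delta>" "\<theta> \<in> ?I" for c \<theta>
    using neck_param_has_derivative(2)[OF that(1) p_pos[OF that(2)]] by (simp add: q_def)
  have cont_s: "continuous_on (?\<Delta> \<times> ?I) (\<lambda>z. neck_param (fst z) (p (snd z)))"
  proof -
    have "continuous_on (?\<Delta> \<times> ?I) (\<lambda>z. (\<lambda>(c :: real^'n, p). neck_param c p) (fst z, p (snd z)))"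
    proof (rule continuous_on_compose2[OF continuous_on_neck_param[OF p_pos[OF m(1)], of "p M"]])
      show "continuous_on (?\<Delta> \<times> ?I) (\<lambda>z. (fst z, p (snd z)))"
        by (intro continuous_intros continuous_on_compose2[OF p_cont]) auto
      show "(\<lambda>z. (fst z, p (snd z))) ` (?\<Delta> \<times> ?I) \<subseteq> ?\<Delta> \<times> {p m..p M}"
        using m M by auto
    qed
    then show ?thesis by simp
  qed
  have cont_w: "continuous_on (?\<Delta> \<times> ?I) (\<lambda>z. w (fst z) k (snd z))" for k
  proof -
    have "\<forall>z\<in>?\<Delta> \<times> ?I. 1 + fst z $ l * neck_param (fst z) (p (snd z)) \<noteq> 0" for l
      using rho_pos by (metis SigmaE fst_conv less_irrefl snd_conv)
    moreover have "\<forall>z\<in>?\<Delta> \<times> ?I. (\<Sum>l\<in>UNIV. fst z $ l / (1 + fst z $ l * neck_param (fst z) (p (snd z)))) \<noteq> 0"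
      using Q_pos unfolding q_def by (metis SigmaE fst_conv less_irrefl snd_conv)
    ultimately show ?thesis
      unfolding w_def q_def by (intro continuous_intros cont_s) auto
  qed
  have cont_w1: "continuous_on ?I (w c k)" if "c \<in> ?\<Delta>" for c k
  proof -
    have "continuous_on ?I (\<lambda>\<theta>. w (fst (c, \<theta>)) k (snd (c, \<theta>)))"
      by (rule continuous_on_compose2[OF cont_w]) (use that in \<open>auto intro!: continuous_intros\<close>)
    then show ?thesis by simp
  qed
  define B where "B c = (\<chi> k. integral ?I (w c k))" for c
  obtain c where c: "c \<in> ?\<Delta>" and Bc: "B c = \<beta>"
  proof (rule face_preserving_map_onto[where B = B and b = \<beta>])
    show "continuous_on ?\<Delta> B"
      unfolding B_def
    proof (intro continuous_on_vec_lambda)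
      fix k
      have "continuous_on ?\<Delta> (\<lambda>c. integral (cbox \<theta>0 \<theta>1) (w c k))"
        by (rule integral_continuous_on_param) (use cont_w[of k] in \<open>simp add: case_prod_unfold\<close>)
      then show "continuous_on ?\<Delta> (\<lambda>c. integral ?I (w c k))" by simp
    qed
    show "(\<Sum>k\<in>UNIV. B c $ k) = (\<Sum>k\<in>UNIV. \<beta> $ k)" if c: "c \<in> ?\<Delta>" for c
    proof -
      have "(\<Sum>k\<in>UNIV. B c $ k) = integral ?I (\<lambda>\<theta>. \<Sum>k\<in>UNIV. w c k \<theta>)"
        unfolding B_def
        by (simp add: integral_sum integrable_continuous_real cont_w1[OF c])
      also have "\<dots> = integral ?I (\<lambda>\<theta>. 1)"
        using Q_pos[OF c] by (intro integral_cong) (force simp: w_def sum_divide_distrib[symmetric])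
      finally show ?thesis using sum\<beta> \<open>\<theta>0 < \<theta>1\<close> by simp
    qed
    show "B c $ k = 0" if "c \<in> ?\<Delta>" "c $ k = 0" for c k
      using that by (simp add: B_def w_def[abs_def] q_def)
    show "0 \<le> \<beta> $ k" for k by (rule \<beta>)
  qed (use that in blast)
  show ?thesis
  proof (rule that[where c = c and s = "\<lambda>\<theta>. neck_param c (p \<theta>)"])
    show "c \<in> ?\<Delta>" by (rule c)
    have int: "integral ?I (w c k) = \<beta> $ k" for k using Bc by (auto simp: B_def)
    then show "integral ?I (\<lambda>\<theta>. (c $ k / (1 + c $ k * neck_param c (p \<theta>))) /
        (\<Sum>l\<in>UNIV. c $ l / (1 + c $ l * neck_param c (p \<theta>)))) = \<beta> $ k" for k
      by (simp add: w_def[abs_def] q_def[abs_def])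
    show "\<beta> $ k = 0" if "c $ k = 0" for k
      using int[of k] that by (simp add: w_def[abs_def] q_def)
    show "0 < 1 + c $ k * neck_param c (p \<theta>)" if "\<theta> \<in> ?I" for \<theta> k
      by (rule rho_pos[OF c that])
    fix \<theta> assume \<theta>: "\<theta> \<in> ?I"
    have dp: "(p has_real_derivative 2 * tan \<theta> * p \<theta>) (at \<theta>)"
      unfolding p_def using cos_pos[OF \<theta>]
      by (auto intro!: derivative_eq_intros simp: tan_def power2_eq_square field_simps)
    have "((\<lambda>\<theta>. neck_param c (p \<theta>)) has_real_derivative
        inverse (p \<theta> * (\<Sum>l\<in>UNIV. q c l \<theta>)) * (2 * tan \<theta> * p \<theta>)) (at \<theta>)"
      using neck_param_has_derivative(1)[OF c p_pos[OF \<theta>]]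
      by (intro DERIV_chain2[OF _ dp]) (simp add: q_def)
    moreover have "inverse (p \<theta> * (\<Sum>l\<in>UNIV. q c l \<theta>)) * (2 * tan \<theta> * p \<theta>)
       = 2 * tan \<theta> / (\<Sum>l\<in>UNIV. q c l \<theta>)"
      using p_pos[OF \<theta>] by (simp add: field_simps)
    ultimately show "((\<lambda>\<theta>. neck_param c (p \<theta>)) has_real_derivative
        2 * tan \<theta> / (\<Sum>l\<in>UNIV. c $ l / (1 + c $ l * neck_param c (p \<theta>)))) (at \<theta>)"
      by (simp add: q_def)
  qed
qed

text \<open>Time enters through the equation \<open>\<theta>' = T \<Sum>\<^sub>l c\<^sub>l/\<rho>\<^sub>l\<close> for the phase, whose right-hand
  side is a function of \<open>\<theta>\<close> alone. The constant \<open>T\<close> is absorbed in \<open>c\<close>.\<close>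

lemma neck_ode_solution:
  fixes \<beta> :: "'n::finite \<Rightarrow> real"
  assumes \<beta>: "\<And>k. 0 \<le> \<beta> k" and \<theta>0: "-pi/2 < \<theta>0" and \<theta>1: "\<theta>0 + (\<Sum>k\<in>UNIV. \<beta> k) < pi/2"
  obtains c :: "'n \<Rightarrow> real" and b \<rho> :: "'n \<Rightarrow> real \<Rightarrow> real"
  where "\<And>k. 0 \<le> c k" "\<And>k. c k = 0 \<Longrightarrow> \<beta> k = 0" "\<And>k. b k 0 = 0" "\<And>k. b k 1 = \<beta> k"
    "\<And>t k. t \<in> {0..1} \<Longrightarrow> 0 < \<rho> k t"
    "\<And>t. t \<in> {0..1} \<Longrightarrow> \<theta>0 + (\<Sum>k\<in>UNIV. b k t) \<in> {-pi/2<..<pi/2}"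
    "\<And>t k. t \<in> {0..1} \<Longrightarrow> (b k has_real_derivative c k / \<rho> k t) (at t within {0..1})"
    "\<And>t k. t \<in> {0..1} \<Longrightarrow>
       (\<rho> k has_real_derivative 2 * c k * tan (\<theta>0 + (\<Sum>k\<in>UNIV. b k t))) (at t within {0..1})"
proof (cases "(\<Sum>k\<in>UNIV. \<beta> k) = 0")
  case True
  then have "\<beta> k = 0" for k using \<beta> by (simp add: sum_nonneg_eq_0_iff)
  then show ?thesis
    using \<theta>0 \<theta>1 True by (intro that[of "\<lambda>_. 0" "\<lambda>_ _. 0" "\<lambda>_ _. 1"]) auto
next
  case False
  define \<theta>1 where "\<theta>1 = \<theta>0 + (\<Sum>k\<in>UNIV. \<beta> k)"
  have lt: "\<theta>0 < \<theta>1" using False sum_nonneg[of UNIV \<beta>] \<beta> by (simp add: \<theta>1_def less_le)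
  let ?I = "{\<theta>0..\<theta>1}"
  obtain c :: "real^'n" and s where c: "c \<in> prob_simplex"
    and c0: "\<And>k. c $ k = 0 \<Longrightarrow> \<beta> k = 0"
    and pos: "\<And>\<theta> k. \<theta> \<in> ?I \<Longrightarrow> 0 < 1 + c $ k * s \<theta>"
    and ds: "\<And>\<theta>. \<theta> \<in> ?I \<Longrightarrow> (s has_real_derivative 2 * tan \<theta> / (\<Sum>l\<in>UNIV. c $ l / (1 + c $ l * s \<theta>))) (at \<theta>)"
    and int: "\<And>k. integral ?I (\<lambda>\<theta>. (c $ k / (1 + c $ k * s \<theta>)) / (\<Sum>l\<in>UNIV. c $ l / (1 + c $ l * s \<theta>))) = \<beta> k"
  proof (rule prescribed_angle_increments[of "\<chi> k. \<beta> k" \<theta>0 \<theta>1, unfolded vec_lambda_beta])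
    show "\<theta>0 < \<theta>1" "-pi/2 < \<theta>0" "\<theta>1 < pi/2" "(\<Sum>k\<in>UNIV. \<beta> k) = \<theta>1 - \<theta>0"
      using lt \<theta>0 \<theta>1 by (simp_all add: \<theta>1_def)
  qed (use \<beta> in simp, rule that)
  define Q where "Q \<theta> = (\<Sum>l\<in>UNIV. c $ l / (1 + c $ l * s \<theta>))" for \<theta>
  have s_cont: "continuous_on ?I s"
    by (rule DERIV_continuous_on, rule has_field_derivative_at_within, rule ds)
  have Q_cont: "continuous_on ?I Q"
    unfolding Q_def by (intro continuous_intros s_cont) (use less_imp_neq[OF pos] in force)
  have Q_pos: "0 < Q \<theta>" if "\<theta> \<in> ?I" for \<theta>
  proof -
    obtain k where "c $ k > 0" by (rule prob_simplex_pos_coord[OF c])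
    then show ?thesis unfolding Q_def
      using prob_simplex_D(1)[OF c] pos[OF that]
      by (intro sum_pos2[of _ k]) (auto simp: less_imp_le)
  qed
  obtain T y where T: "T > 0" and y0: "y 0 = \<theta>0" and y1: "y 1 = \<theta>1"
    and yI: "\<And>t. t \<in> {0..1} \<Longrightarrow> y t \<in> ?I"
    and dy: "\<And>t. t \<in> {0..1} \<Longrightarrow> (y has_real_derivative T * Q (y t)) (at t within {0..1})"
    by (rule autonomous_ode_connects[OF lt Q_cont Q_pos]) (assumption, rule that)
  define w where "w k \<theta> = (c $ k / (1 + c $ k * s \<theta>)) / Q \<theta>" for k \<theta>
  have w_cont: "continuous_on ?I (w k)" for k
    unfolding w_def by (intro continuous_intros s_cont Q_cont) (use less_imp_neq[OF pos] less_imp_neq[OF Q_pos] in force)+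
  define b where "b k t = integral {\<theta>0..y t} (w k)" for k t
  have y_sum: "\<theta>0 + (\<Sum>k\<in>UNIV. b k t) = y t" if t: "t \<in> {0..1}" for t
  proof -
    have sub: "{\<theta>0..y t} \<subseteq> ?I" using yI[OF t] by auto
    have "(\<Sum>k\<in>UNIV. b k t) = integral {\<theta>0..y t} (\<lambda>\<theta>. \<Sum>k\<in>UNIV. w k \<theta>)"
      unfolding b_def
      by (simp add: integral_sum integrable_continuous_real continuous_on_subset[OF w_cont sub])
    also have "\<dots> = integral {\<theta>0..y t} (\<lambda>\<theta>. 1)"
    proof (rule integral_cong)
      fix \<theta> assume "\<theta> \<in> {\<theta>0..y t}"
      then have "0 < Q \<theta>" using sub Q_pos by blast
      then show "(\<Sum>k\<in>UNIV. w k \<theta>) = 1"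
        unfolding w_def sum_divide_distrib[symmetric] Q_def[symmetric] by simp
    qed
    finally show ?thesis using yI[OF t] by simp
  qed
  show ?thesis
  proof (rule that[of "\<lambda>k. T * c $ k" b "\<lambda>k t. 1 + c $ k * s (y t)"])
    show "0 \<le> T * c $ k" for k using T prob_simplex_D(1)[OF c] by simp
    show "\<beta> k = 0" if "T * c $ k = 0" for k using c0 that T by simp
    show "b k 0 = 0" for k by (simp add: b_def y0)
    show "b k 1 = \<beta> k" for k using int[of k] by (simp add: b_def y1 w_def[abs_def] Q_def)
    fix t :: real assume t: "t \<in> {0..1}"
    have yt: "y t \<in> ?I" using yI[OF t] .
    show "0 < 1 + c $ k * s (y t)" for k using pos[OF yt] .
    show "\<theta>0 + (\<Sum>k\<in>UNIV. b k t) \<in> {-pi/2<..<pi/2}"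
      unfolding y_sum[OF t] using yt \<theta>0 \<theta>1 by (auto simp: \<theta>1_def)
    fix k
    have "((\<lambda>x. integral {\<theta>0..x} (w k)) has_real_derivative w k (y t)) (at (y t) within ?I)"
      by (rule integral_has_real_derivative[OF w_cont yt])
    then have "((\<lambda>x. integral {\<theta>0..x} (w k)) has_real_derivative w k (y t)) (at (y t) within y ` {0..1})"
      by (rule DERIV_subset) (use yI in auto)
    then have "(b k has_real_derivative w k (y t) * (T * Q (y t))) (at t within {0..1})"
      unfolding b_def[abs_def] using DERIV_image_chain[OF _ dy[OF t]] by (simp add: o_def)
    moreover have "w k (y t) * (T * Q (y t)) = T * c $ k / (1 + c $ k * s (y t))"
      using Q_pos[OF yt] by (simp add: w_def)
    ultimately show "(b k has_real_derivative T * c $ k / (1 + c $ k * s (y t))) (at t within {0..1})"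
      by simp
    have "((\<lambda>t. s (y t)) has_real_derivative 2 * tan (y t) / Q (y t) * (T * Q (y t))) (at t within {0..1})"
      by (rule DERIV_chain2[OF _ dy[OF t]]) (use ds[OF yt] in \<open>simp add: Q_def\<close>)
    then have "((\<lambda>t. 1 + c $ k * s (y t)) has_real_derivative
        c $ k * (2 * tan (y t) / Q (y t) * (T * Q (y t)))) (at t within {0..1})"
      by (auto intro!: derivative_eq_intros)
    moreover have "c $ k * (2 * tan (y t) / Q (y t) * (T * Q (y t))) = 2 * (T * c $ k) * tan (y t)"
      using Q_pos[OF yt] by simp
    ultimately show "((\<lambda>t. 1 + c $ k * s (y t)) has_real_derivative
        2 * (T * c $ k) * tan (\<theta>0 + (\<Sum>k\<in>UNIV. b k t))) (at t within {0..1})"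
      unfolding y_sum[OF t] by (simp only:)
  qed
qed

section \<open>Smooth paths\<close>

text \<open>A bootstrap principle: solutions of a differential equation are smooth because differentiation
  does not leave the class of expressions in them.\<close>

lemma smooth_on_unit_coinduct:
  assumes "f \<in> F"
    and step: "\<And>f. f \<in> F \<Longrightarrow> \<exists>f'\<in>F. \<forall>t\<in>{0..1}. (f has_vector_derivative f' t) (at t within {0..1})"
  shows "smooth_on_unit f"
proof -
  obtain d where d: "\<And>f. f \<in> F \<Longrightarrow> d f \<in> F"
    "\<And>f t. f \<in> F \<Longrightarrow> t \<in> {0..1} \<Longrightarrow> (f has_vector_derivative d f t) (at t within {0..1})"
    using step by metis
  have "(d ^^ k) f \<in> F" for k by (induction k) (use assms(1) d(1) in auto)
  then show ?thesis
    unfolding smooth_on_unit_def using d(2) by (intro exI[of _ "\<lambda>k. (d ^^ k) f"]) auto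
qed

lemma smooth_on_unit_bounded_linear:
  assumes "bounded_linear T" "smooth_on_unit f"
  shows "smooth_on_unit (\<lambda>t. T (f t))"
proof -
  obtain D where D: "D 0 = f"
    "\<And>k t. t \<in> {0..1} \<Longrightarrow> (D k has_vector_derivative D (Suc k) t) (at t within {0..1})"
    using assms(2) by (auto simp: smooth_on_unit_def)
  show ?thesis
    unfolding smooth_on_unit_def
    using D bounded_linear.has_vector_derivative[OF assms(1)]
    by (intro exI[of _ "\<lambda>k t. T (D k t)"]) auto
qed

lemma smooth_on_unit_sum:
  assumes "\<And>i. i \<in> I \<Longrightarrow> smooth_on_unit (f i)"
  shows "smooth_on_unit (\<lambda>t. \<Sum>i\<in>I. f i t)"
proof -
  have "\<forall>i\<in>I. \<exists>D. D 0 = f i \<and> (\<forall>k. \<forall>t\<in>{0..1}. (D k has_vector_derivative D (Suc k) t) (at t within {0..1}))"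
    using assms by (simp add: smooth_on_unit_def)
  then obtain D where D: "\<And>i. i \<in> I \<Longrightarrow> D i 0 = f i"
    "\<And>i k t. i \<in> I \<Longrightarrow> t \<in> {0..1} \<Longrightarrow> (D i k has_vector_derivative D i (Suc k) t) (at t within {0..1})"
    by (metis (no_types, lifting))
  show ?thesis
    unfolding smooth_on_unit_def
    by (intro exI[of _ "\<lambda>k t. \<Sum>i\<in>I. D i k t"]) (auto simp: D(1) intro!: has_vector_derivative_sum D(2))
qed

text \<open>The expressions for the bootstrap: polynomials in the functions in \<open>G\<close>.\<close>

inductive_set function_algebra :: "(real \<Rightarrow> complex) set \<Rightarrow> (real \<Rightarrow> complex) set" for G where
  generator: "f \<in> G \<Longrightarrow> f \<in> function_algebra G"
| const: "(\<lambda>_. a) \<in> function_algebra G"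
| add: "f \<in> function_algebra G \<Longrightarrow> g \<in> function_algebra G \<Longrightarrow> (\<lambda>t. f t + g t) \<in> function_algebra G"
| mult: "f \<in> function_algebra G \<Longrightarrow> g \<in> function_algebra G \<Longrightarrow> (\<lambda>t. f t * g t) \<in> function_algebra G"

lemma function_algebra_sum:
  "finite I \<Longrightarrow> (\<And>i. i \<in> I \<Longrightarrow> f i \<in> function_algebra G) \<Longrightarrow> (\<lambda>t. \<Sum>i\<in>I. f i t) \<in> function_algebra G"
  by (induction I rule: finite_induct) (auto intro: function_algebra.intros)

lemma smooth_function_algebra:
  assumes "\<And>f. f \<in> G \<Longrightarrow> \<exists>f'\<in>function_algebra G. \<forall>t\<in>{0..1}. (f has_vector_derivative f' t) (at t within {0..1})"
    and "f \<in> function_algebra G"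
  shows "smooth_on_unit f"
  using assms(2)
proof (rule smooth_on_unit_coinduct)
  fix f assume "f \<in> function_algebra G"
  then show "\<exists>f'\<in>function_algebra G. \<forall>t\<in>{0..1}. (f has_vector_derivative f' t) (at t within {0..1})"
  proof induction
    case (generator f)
    then show ?case by (rule assms(1))
  next
    case (const a)
    show ?case by (rule bexI[OF _ function_algebra.const[of 0]]) simp
  next
    case (add f g)
    then obtain f' g' where "f' \<in> function_algebra G" "g' \<in> function_algebra G"
      "\<forall>t\<in>{0..1}. (f has_vector_derivative f' t) (at t within {0..1})"
      "\<forall>t\<in>{0..1}. (g has_vector_derivative g' t) (at t within {0..1})" by blast
    then show ?case
      by (intro bexI[of _ "\<lambda>t. f' t + g' t"]) (auto intro: function_algebra.add has_vector_derivative_add)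
  next
    case (mult f g)
    then obtain f' g' where f': "f' \<in> function_algebra G" and g': "g' \<in> function_algebra G"
      and d: "\<forall>t\<in>{0..1}. (f has_vector_derivative f' t) (at t within {0..1})"
      "\<forall>t\<in>{0..1}. (g has_vector_derivative g' t) (at t within {0..1})" by blast
    show ?case
    proof (rule bexI[of _ "\<lambda>t. f t * g' t + f' t * g t"])
      show "\<forall>t\<in>{0..1}. ((\<lambda>t. f t * g t) has_vector_derivative f t * g' t + f' t * g t) (at t within {0..1})"
        using d by (auto intro: has_vector_derivative_mult)
      show "(\<lambda>t. f t * g' t + f' t * g t) \<in> function_algebra G"
        using f' g' mult by (intro function_algebra.intros(3,4))
    qed
  qed
qed

lemma prod_cis: "(\<Prod>k\<in>I. cis (f k)) = cis (\<Sum>k\<in>I. f k)"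
  by (induction I rule: infinite_finite_induct) (simp_all add: cis_mult)

section \<open>Diagonal paths that solve the neck equations\<close>

text \<open>The summands of the lifting as bounded linear functions of their complex coefficient,
  so that smoothness of the lifting reduces to smoothness of complex-valued functions.\<close>

definition coord_lift :: "('n \<Rightarrow> complex^'n) \<Rightarrow> 'n \<Rightarrow> complex \<Rightarrow> (real^'n) \<Rightarrow>\<^sub>L (complex^'n)" where
  "coord_lift u k a = Blinfun (\<lambda>x. x $ k *\<^sub>R (a *s u k))"

lemma coord_lift_apply: "blinfun_apply (coord_lift u k a) x = x $ k *\<^sub>R (a *s u k)"
proof -
  have "linear (\<lambda>x :: real^'a. x $ k *\<^sub>R (a *s u k))"
    by (rule linearI) (simp_all add: scaleR_add_left)
  then have "bounded_linear (\<lambda>x :: real^'a. x $ k *\<^sub>R (a *s u k))"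
    by (simp add: linear_conv_bounded_linear)
  then show ?thesis by (simp add: coord_lift_def bounded_linear_Blinfun_apply)
qed

lemma bounded_linear_coord_lift: "bounded_linear (coord_lift u k)"
proof -
  have "linear (coord_lift u k)"
  proof (rule linearI; rule blinfun_eqI)
    show "blinfun_apply (coord_lift u k (a + a')) x = blinfun_apply (coord_lift u k a + coord_lift u k a') x" for a a' x
      by (simp add: coord_lift_apply blinfun.add_left vec.scale_left_distrib scaleR_add_right)
    show "blinfun_apply (coord_lift u k (r *\<^sub>R a)) x = blinfun_apply (r *\<^sub>R coord_lift u k a) x" for r a x
      by (simp add: coord_lift_apply blinfun.scaleR_left vec_eq_iff)
  qed
  then show ?thesis by (simp add: linear_conv_bounded_linear)
qed

text \<open>The numbers \<open>\<rho>\<^sub>k\<close> and \<open>b\<^sub>k\<close> are the squared modulus and the argument of the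
  \<open>k\<close>-th coefficient of the lifting \<open>\<Psi>\<close>, and \<open>h\<close> will be the derivative of the path
  \<open>L\<close>.\<close>

locale neck =
  fixes u :: "'n::finite \<Rightarrow> complex^'n" and \<theta>0 :: real and c :: "'n \<Rightarrow> real" and b \<rho> :: "'n \<Rightarrow> real \<Rightarrow> real"
  assumes frame: "unitary_frame u"
    and frame_phase: "\<exists>s\<in>{-1, 1}. Omega u = of_real s * cis \<theta>0"
    and c_nonneg: "\<And>k. 0 \<le> c k"
    and \<rho>_pos: "\<And>t k. t \<in> {0..1} \<Longrightarrow> 0 < \<rho> k t"
    and angle_bounds: "\<And>t. t \<in> {0..1} \<Longrightarrow> \<theta>0 + (\<Sum>k\<in>UNIV. b k t) \<in> {-pi/2<..<pi/2}"
    and b_deriv: "\<And>t k. t \<in> {0..1} \<Longrightarrow> (b k has_real_derivative c k / \<rho> k t) (at t within {0..1})"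
    and \<rho>_deriv: "\<And>t k. t \<in> {0..1} \<Longrightarrow>
       (\<rho> k has_real_derivative 2 * c k * tan (\<theta>0 + (\<Sum>k\<in>UNIV. b k t))) (at t within {0..1})"
begin

definition "\<theta> t = \<theta>0 + (\<Sum>k\<in>UNIV. b k t)"

definition "g k t = complex_of_real (sqrt (\<rho> k t)) * cis (b k t)"

definition "\<Psi> t = (\<Sum>k\<in>UNIV. coord_lift u k (g k t))"

definition "L t = range (blinfun_apply (\<Psi> t))"

text \<open>For \<open>z \<in> L t\<close> the quotients are the coordinates of \<open>z\<close> with respect
  to the lifting, so that \<open>h t\<close> is the constant form \<open>-1/2 \<Sum>\<^sub>k c\<^sub>k x\<^sub>k\<^sup>2\<close> in these
  coordinates.\<close>

definition "h t z = - (1/2) * (\<Sum>k\<in>UNIV. c k * (z \<bullet> (g k t *s u k) / \<rho> k t)\<^sup>2)"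

lemma cos_\<theta>: "t \<in> {0..1} \<Longrightarrow> 0 < cos (\<theta> t)"
  using angle_bounds[of t] by (intro cos_gt_zero_pi) (auto simp: \<theta>_def)

lemma g_deriv:
  assumes t: "t \<in> {0..1}"
  shows "(g k has_vector_derivative of_real (c k / \<rho> k t) * (of_real (tan (\<theta> t)) + \<i>) * g k t) (at t within {0..1})"
proof -
  have \<rho>: "0 < \<rho> k t" by (rule \<rho>_pos[OF t])
  have "((\<lambda>t. sqrt (\<rho> k t)) has_real_derivative c k * tan (\<theta> t) / sqrt (\<rho> k t)) (at t within {0..1})"
    using \<rho> by (auto intro!: derivative_eq_intros \<rho>_deriv[OF t] simp: \<theta>_def field_simps)
  then have s: "((\<lambda>t. complex_of_real (sqrt (\<rho> k t))) has_vector_derivative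
      of_real (c k * tan (\<theta> t) / sqrt (\<rho> k t))) (at t within {0..1})"
    by (intro has_vector_derivative_of_real) (simp add: has_real_derivative_iff_has_vector_derivative)
  have "((\<lambda>t. exp (\<i> * complex_of_real (b k t))) has_vector_derivative
      (\<i> * of_real (c k / \<rho> k t)) * exp (\<i> * complex_of_real (b k t))) (at t within {0..1})"
  proof -
    have "((\<lambda>t. complex_of_real (b k t)) has_vector_derivative of_real (c k / \<rho> k t)) (at t within {0..1})"
      using b_deriv[OF t]
      by (intro has_vector_derivative_of_real) (simp add: has_real_derivative_iff_has_vector_derivative)
    then have "((\<lambda>t. \<i> * complex_of_real (b k t)) has_vector_derivative \<i> * of_real (c k / \<rho> k t)) (at t within {0..1})"
      by (rule has_vector_derivative_mult_right)
    from field_vector_diff_chain_within[OF this, of exp] show ?thesis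
      by (simp add: o_def DERIV_subset[OF DERIV_exp])
  qed
  then have e: "((\<lambda>t. cis (b k t)) has_vector_derivative \<i> * of_real (c k / \<rho> k t) * cis (b k t)) (at t within {0..1})"
    by (simp add: cis_conv_exp)
  have "complex_of_real (sqrt (\<rho> k t)) * (\<i> * of_real (c k / \<rho> k t) * cis (b k t))
      + of_real (c k * tan (\<theta> t) / sqrt (\<rho> k t)) * cis (b k t)
      = of_real (c k / \<rho> k t) * (of_real (tan (\<theta> t)) + \<i>) * g k t"
  proof -
    have "c k * tan (\<theta> t) / sqrt (\<rho> k t) = c k / \<rho> k t * tan (\<theta> t) * sqrt (\<rho> k t)"
      using \<rho> by (simp add: field_simps)
    then show ?thesis by (simp add: g_def algebra_simps add_divide_distrib)
  qed
  then show ?thesis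
    using has_vector_derivative_mult[OF s e] by (simp add: g_def[abs_def])
qed

text \<open>The functions \<open>g\<^sub>k\<close>, \<open>1/\<rho>\<^sub>k\<close> and \<open>tan \<theta>\<close> generate an algebra that is closed under
  differentiation.\<close>

lemma smooth_g: "smooth_on_unit (g k)"
proof -
  let ?q = "\<lambda>k t. complex_of_real (1 / \<rho> k t)" and ?T = "\<lambda>t. complex_of_real (tan (\<theta> t))"
  define G where "G = range g \<union> range ?q \<union> {?T}"
  have mem: "g k \<in> function_algebra G" "?q k \<in> function_algebra G" "?T \<in> function_algebra G" for k
    by (auto simp: G_def intro!: function_algebra.generator)
  show ?thesis
  proof (rule smooth_function_algebra[of G])
    show "g k \<in> function_algebra G" by (rule mem)
    fix f assume "f \<in> G"
    then consider k where "f = g k" | k where "f = ?q k" | "f = ?T" by (auto simp: G_def)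
    then show "\<exists>f'\<in>function_algebra G. \<forall>t\<in>{0..1}. (f has_vector_derivative f' t) (at t within {0..1})"
    proof cases
      case 1
      have "(\<lambda>t. (of_real (c k) * ?q k t) * (?T t + \<i>) * g k t) \<in> function_algebra G"
        by (intro function_algebra.intros(2-4) mem)
      then show ?thesis
        by (rule bexI[rotated]) (use g_deriv in \<open>simp add: 1\<close>)
    next
      case 2
      have "(\<lambda>t. of_real (-2 * c k) * ?T t * ?q k t * ?q k t) \<in> function_algebra G"
        by (intro function_algebra.intros(2-4) mem)
      then show ?thesis
      proof (rule bexI[rotated], intro ballI)
        fix t :: real assume t: "t \<in> {0..1}"
        have "((\<lambda>t. 1 / \<rho> k t) has_real_derivative -2 * c k * tan (\<theta> t) * (1 / \<rho> k t) * (1 / \<rho> k t)) (at t within {0..1})"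
          using \<rho>_pos[OF t, of k]
          by (auto intro!: derivative_eq_intros \<rho>_deriv[OF t] simp: \<theta>_def field_simps)
        then have "(?q k has_vector_derivative of_real (-2 * c k * tan (\<theta> t) * (1 / \<rho> k t) * (1 / \<rho> k t))) (at t within {0..1})"
          by (intro has_vector_derivative_of_real) (simp add: has_real_derivative_iff_has_vector_derivative)
        then show "(f has_vector_derivative of_real (-2 * c k) * ?T t * ?q k t * ?q k t) (at t within {0..1})"
          by (simp add: 2)
      qed
    next
      case 3
      have "(\<lambda>t. (1 + ?T t * ?T t) * (\<Sum>k\<in>UNIV. of_real (c k) * ?q k t)) \<in> function_algebra G"
        by (intro function_algebra.intros(2-4) function_algebra_sum mem finite)
      then show ?thesis
      proof (rule bexI[rotated], intro ballI)
        fix t :: real assume t: "t \<in> {0..1}"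
        have "(\<theta> has_real_derivative (\<Sum>k\<in>UNIV. c k / \<rho> k t)) (at t within {0..1})"
          unfolding \<theta>_def[abs_def] by (auto intro!: derivative_eq_intros b_deriv[OF t])
        then have "((\<lambda>t. tan (\<theta> t)) has_real_derivative inverse ((cos (\<theta> t))\<^sup>2) * (\<Sum>k\<in>UNIV. c k / \<rho> k t)) (at t within {0..1})"
          by (intro DERIV_chain2[OF DERIV_tan]) (use cos_\<theta>[OF t] in auto)
        then have "(?T has_vector_derivative of_real (inverse ((cos (\<theta> t))\<^sup>2) * (\<Sum>k\<in>UNIV. c k / \<rho> k t))) (at t within {0..1})"
          by (intro has_vector_derivative_of_real) (simp add: has_real_derivative_iff_has_vector_derivative)
        moreover have "inverse ((cos (\<theta> t))\<^sup>2) = 1 + tan (\<theta> t) * tan (\<theta> t)"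
          using tan_sec[of "\<theta> t"] cos_\<theta>[OF t] by (simp add: power2_eq_square)
        ultimately show "(f has_vector_derivative (1 + ?T t * ?T t) * (\<Sum>k\<in>UNIV. of_real (c k) * ?q k t)) (at t within {0..1})"
          by (simp add: 3)
      qed
    qed
  qed
qed

lemma \<Psi>_apply: "blinfun_apply (\<Psi> t) x = frame_map (\<lambda>k. g k t *s u k) x"
  by (simp add: \<Psi>_def blinfun.sum_left coord_lift_apply frame_map_def)

lemma herm_g:
  assumes "t \<in> {0..1}"
  shows "cnj (g k t) * g k t = of_real (\<rho> k t)"
proof -
  have "cnj (g k t) * g k t = of_real (sqrt (\<rho> k t) * sqrt (\<rho> k t)) * (cnj (cis (b k t)) * cis (b k t))"
    by (simp only: g_def complex_cnj_mult complex_cnj_complex_of_real of_real_mult mult_ac)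
  also have "\<dots> = of_real (\<rho> k t)"
    using \<rho>_pos[OF assms, of k] by (simp add: cis_cnj cis_mult)
  finally show ?thesis .
qed

lemma herm_\<Psi>:
  assumes t: "t \<in> {0..1}"
  shows "herm (g k t *s u k) (blinfun_apply (\<Psi> t) x) = of_real (\<rho> k t * x $ k)"
    and "herm (blinfun_apply (\<Psi> t) x) (blinfun_apply (\<Psi> t) y) = of_real (\<Sum>k\<in>UNIV. \<rho> k t * x $ k * y $ k)"
proof -
  show 1: "herm (g k t *s u k) (blinfun_apply (\<Psi> t) x) = of_real (\<rho> k t * x $ k)" for k x
  proof -
    have "herm (g k t *s u k) (blinfun_apply (\<Psi> t) x)
        = (\<Sum>j\<in>UNIV. if k = j then of_real (x $ j) * (cnj (g j t) * g j t) else 0)"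
      unfolding \<Psi>_apply frame_map_def herm_simps unitary_frameD[OF frame] by (intro sum.cong) auto
    then show ?thesis using herm_g[OF t] by (simp add: mult.commute)
  qed
  have "herm (blinfun_apply (\<Psi> t) x) (blinfun_apply (\<Psi> t) y)
      = (\<Sum>k\<in>UNIV. of_real (x $ k) * herm (g k t *s u k) (blinfun_apply (\<Psi> t) y))"
    unfolding \<Psi>_apply[of t x] frame_map_def herm_sum_left herm_scaleR_left ..
  then show "herm (blinfun_apply (\<Psi> t) x) (blinfun_apply (\<Psi> t) y) = of_real (\<Sum>k\<in>UNIV. \<rho> k t * x $ k * y $ k)"
    unfolding 1 by (simp add: mult_ac)
qed

lemma inj_\<Psi>: "t \<in> {0..1} \<Longrightarrow> inj (blinfun_apply (\<Psi> t))"
proof (rule injI)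
  fix x y assume t: "t \<in> {0..1}" and eq: "blinfun_apply (\<Psi> t) x = blinfun_apply (\<Psi> t) y"
  have "\<rho> k t * x $ k = \<rho> k t * y $ k" for k
    using herm_\<Psi>(1)[OF t, of k x] herm_\<Psi>(1)[OF t, of k y] eq by (metis of_real_eq_iff)
  then show "x = y" using \<rho>_pos[OF t] by (simp add: vec_eq_iff) (metis less_irrefl)
qed

lemma L_eq:
  assumes t: "t \<in> {0..1}"
  shows "L t = range (frame_map (\<lambda>k. cis (b k t) *s u k))"
proof -
  have 1: "blinfun_apply (\<Psi> t) x = frame_map (\<lambda>k. cis (b k t) *s u k) (\<chi> k. sqrt (\<rho> k t) * x $ k)" for x
    unfolding \<Psi>_apply frame_map_def g_def by (intro sum.cong) (simp_all add: scaleR_eq_mult mult_ac)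
  have "frame_map (\<lambda>k. cis (b k t) *s u k) y = blinfun_apply (\<Psi> t) (\<chi> k. y $ k / sqrt (\<rho> k t))" for y
  proof -
    have "(\<chi> k. sqrt (\<rho> k t) * (\<chi> k. y $ k / sqrt (\<rho> k t)) $ k) = y"
      using \<rho>_pos[OF t] by (simp add: vec_eq_iff) (metis less_irrefl)
    then show ?thesis unfolding 1 by simp
  qed
  then have "range (frame_map (\<lambda>k. cis (b k t) *s u k)) \<subseteq> range (blinfun_apply (\<Psi> t))" by blast
  moreover have "range (blinfun_apply (\<Psi> t)) \<subseteq> range (frame_map (\<lambda>k. cis (b k t) *s u k))"
    unfolding 1 by blast
  ultimately show ?thesis unfolding L_def by blast
qed

lemma unitary_rotated_frame: "unitary_frame (\<lambda>k. cis (b k t) *s u k)"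
  using frame by (simp add: unitary_frame_def herm_simps cis_cnj cis_mult)

lemma L_LG_plus:
  assumes t: "t \<in> {0..1}"
  shows "L t \<in> LG_plus"
proof -
  let ?e = "\<lambda>k. cis (b k t) *s u k"
  have lag: "lagrangian (L t)"
    unfolding L_eq[OF t] by (rule lagrangian_range_frame_map[OF unitary_rotated_frame])
  obtain s where s: "s \<in> {-1, 1}" "Omega u = of_real s * cis \<theta>0" using frame_phase by blast
  have "Omega ?e = of_real s * cis (\<theta> t)"
    by (simp add: Omega_scale prod_cis s(2) \<theta>_def cis_mult[symmetric])
  then have "Re (Omega ?e) \<noteq> 0" using s(1) cos_\<theta>[OF t] by auto
  moreover have "?e j \<in> L t" for j
    unfolding L_eq[OF t] using frame_map_axis[of ?e j] by (metis rangeI)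
  ultimately show ?thesis
    using lag unfolding LG_plus_def lagrangian_def by (intro CollectI conjI exI[of _ ?e]) auto
qed

lemma lifting_\<Psi>: "lifting L \<Psi>"
proof -
  have "smooth_on_unit \<Psi>"
    unfolding \<Psi>_def[abs_def]
    by (intro smooth_on_unit_sum smooth_on_unit_bounded_linear[OF bounded_linear_coord_lift] smooth_g)
  then show ?thesis
    by (simp add: lifting_def L_def bij_betw_def inj_\<Psi>)
qed

text \<open>The velocity of \<open>\<Psi>\<close> at \<open>x\<close> is \<open>i e\<^sup>-\<^sup>i\<^sup>\<theta>\<close> times a vector of \<open>L t\<close>. Both the
  horizontality and the form of the derivative are read off from this: with the velocity in one slot,
  \<^const>\<open>Omega\<close> takes purely imaginary values, and pairing it with \<open>L t\<close> by \<^const>\<open>omega\<close>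
  only sees the component \<open>i cos \<theta>\<close> of the factor.\<close>

lemma velocity_\<Psi>:
  assumes t: "t \<in> {0..1}"
  shows "blinfun_apply (velocity \<Psi> t) x =
    (\<i> * cis (- \<theta> t)) *s blinfun_apply (\<Psi> t) (\<chi> k. c k * x $ k / (\<rho> k t * cos (\<theta> t)))"
proof -
  let ?\<kappa> = "\<lambda>k. complex_of_real (c k / \<rho> k t) * (of_real (tan (\<theta> t)) + \<i>)"
  have "(\<Psi> has_vector_derivative (\<Sum>k\<in>UNIV. coord_lift u k (?\<kappa> k * g k t))) (at t within {0..1})"
    unfolding \<Psi>_def[abs_def]
    by (intro has_vector_derivative_sum bounded_linear.has_vector_derivative[OF bounded_linear_coord_lift] g_deriv[OF t])
  then have v: "velocity \<Psi> t = (\<Sum>k\<in>UNIV. coord_lift u k (?\<kappa> k * g k t))"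
    using t by (intro vector_derivative_within_cbox[of 0 1, unfolded box_real]) auto
  have "of_real (tan (\<theta> t)) + \<i> = \<i> * cis (- \<theta> t) * of_real (1 / cos (\<theta> t))"
    using cos_\<theta>[OF t] by (simp add: complex_eq_iff tan_def)
  then have \<kappa>: "?\<kappa> k = \<i> * cis (- \<theta> t) * of_real (c k / (\<rho> k t * cos (\<theta> t)))" for k
    by (simp add: mult_ac)
  show ?thesis
    unfolding v blinfun.sum_left coord_lift_apply \<kappa> \<Psi>_apply frame_map_def vec.scale_sum_right
    by (intro sum.cong) (simp_all add: scaleR_eq_mult mult_ac)
qed

lemma horizontal_\<Psi>: "horizontal_lifting L \<Psi>"
  unfolding horizontal_lifting_def
proof (intro conjI lifting_\<Psi> ballI allI)
  fix t x j and w :: "'n \<Rightarrow> real^'n" assume t: "t \<in> {0..1::real}"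
  let ?a = "\<i> * cis (- \<theta> t)" and ?x = "\<chi> k. c k * x $ k / (\<rho> k t * cos (\<theta> t))"
  obtain s where s: "Omega u = of_real s * cis \<theta>0" using frame_phase by blast
  have upd: "(\<lambda>i. blinfun_apply (\<Psi> t) (w i))(j := blinfun_apply (velocity \<Psi> t) x)
      = (\<lambda>i. (if i = j then ?a else 1) *s frame_map (\<lambda>k. g k t *s u k) ((w(j := ?x)) i))"
    by (auto simp: velocity_\<Psi>[OF t] \<Psi>_apply)
  have "Omega (\<lambda>k. g k t *s u k) = of_real (s * (\<Prod>k\<in>UNIV. sqrt (\<rho> k t))) * cis (\<theta> t)"
    by (simp add: Omega_scale s g_def prod.distrib prod_cis \<theta>_def cis_mult[symmetric])
  then have "Omega ((\<lambda>i. blinfun_apply (\<Psi> t) (w i))(j := blinfun_apply (velocity \<Psi> t) x))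
      = ?a * (of_real (det (\<chi> i k. (w(j := ?x)) i $ k)) * (of_real (s * (\<Prod>k\<in>UNIV. sqrt (\<rho> k t))) * cis (\<theta> t)))"
    unfolding upd Omega_scale Omega_frame_map by (simp add: prod.delta)
  also have "\<dots> = \<i> * of_real (det (\<chi> i k. (w(j := ?x)) i $ k) * (s * (\<Prod>k\<in>UNIV. sqrt (\<rho> k t)))) * (cis (- \<theta> t) * cis (\<theta> t))"
    by (simp only: of_real_mult mult_ac)
  finally obtain D :: real where "Omega ((\<lambda>i. blinfun_apply (\<Psi> t) (w i))(j := blinfun_apply (velocity \<Psi> t) x))
      = \<i> * of_real D * (cis (- \<theta> t) * cis (\<theta> t))" by blast
  then show "Re (Omega ((\<lambda>i. blinfun_apply (\<Psi> t) (w i))(j := blinfun_apply (velocity \<Psi> t) x))) = 0"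
    by (simp add: cis_mult)
qed

lemma h_\<Psi>:
  assumes t: "t \<in> {0..1}"
  shows "h t (blinfun_apply (\<Psi> t) x) = - (1/2) * (\<Sum>k\<in>UNIV. c k * (x $ k)\<^sup>2)"
proof -
  have "blinfun_apply (\<Psi> t) x \<bullet> (g k t *s u k) = \<rho> k t * x $ k" for k
    using herm_\<Psi>(1)[OF t, of k x] Re_herm[of "g k t *s u k" "blinfun_apply (\<Psi> t) x"] by (simp add: inner_commute)
  then show ?thesis using less_imp_neq[OF \<rho>_pos[OF t]] by (simp add: h_def)
qed

lemma quadratic_h: "quadratic_form_on S (h t)"
proof -
  let ?B = "\<lambda>y z. - (1/2) * (\<Sum>k\<in>UNIV. c k * ((y \<bullet> (g k t *s u k) / \<rho> k t) * (z \<bullet> (g k t *s u k) / \<rho> k t)))"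
  have "bilinear ?B"
    unfolding bilinear_def
    by (intro conjI allI linearI)
       (simp_all add: inner_add_left add_divide_distrib algebra_simps sum.distrib sum_distrib_left)
  then show ?thesis
    unfolding quadratic_form_on_def by (intro exI[of _ ?B]) (simp add: h_def power2_eq_square)
qed

lemma has_LG_derivative_h: "has_LG_derivative L h"
  unfolding has_LG_derivative_def
proof (intro exI[of _ \<Psi>] conjI lifting_\<Psi> ballI allI quadratic_h)
  fix t x assume t: "t \<in> {0..1::real}"
  let ?x = "\<chi> k. c k * x $ k / (\<rho> k t * cos (\<theta> t))"
  have "omega (blinfun_apply (velocity \<Psi> t) x) (blinfun_apply (\<Psi> t) w) = - (\<Sum>k\<in>UNIV. c k * x $ k * w $ k)" for w
  proof -
    have "omega (blinfun_apply (velocity \<Psi> t) x) (blinfun_apply (\<Psi> t) w)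
        = Im (cnj (\<i> * cis (- \<theta> t)) * of_real (\<Sum>k\<in>UNIV. \<rho> k t * ?x $ k * w $ k))"
      unfolding Im_herm[symmetric] velocity_\<Psi>[OF t] herm_mult_left herm_\<Psi>(2)[OF t] ..
    also have "\<dots> = - (\<Sum>k\<in>UNIV. cos (\<theta> t) * (\<rho> k t * ?x $ k * w $ k))"
    proof -
      have im: "Im (cnj (\<i> * cis (- a)) * of_real r) = - (cos a * r)" for a r by simp
      show ?thesis by (subst im) (simp only: sum_distrib_left)
    qed
    also have "\<dots> = - (\<Sum>k\<in>UNIV. c k * x $ k * w $ k)"
    proof -
      have "cos (\<theta> t) * (\<rho> k t * ?x $ k * w $ k) = c k * x $ k * w $ k" for k
        using \<rho>_pos[OF t, of k] cos_\<theta>[OF t] by simp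
      then show ?thesis by (simp only:)
    qed
    finally show ?thesis .
  qed
  moreover have "((\<lambda>y. - (1/2) * (\<Sum>k\<in>UNIV. c k * (y $ k)\<^sup>2)) has_derivative
      (\<lambda>w. - (\<Sum>k\<in>UNIV. c k * x $ k * w $ k))) (at x)"
    by (auto intro!: derivative_eq_intros bounded_linear.has_derivative[OF bounded_linear_vec_nth]
        simp: sum_distrib_left sum_negf[symmetric] mult_ac)
  ultimately show "((\<lambda>y. h t (blinfun_apply (\<Psi> t) y)) has_derivative
      (\<lambda>w. omega (blinfun_apply (velocity \<Psi> t) x) (blinfun_apply (\<Psi> t) w))) (at x)"
    by (simp add: h_\<Psi>[OF t])
qed

lemma geodesic_L: "LG_geodesic L"
  unfolding LG_geodesic_def smooth_LG_path_def
  using L_LG_plus lifting_\<Psi> has_LG_derivative_h horizontal_\<Psi>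
  by (intro conjI exI[of _ h] exI[of _ \<Psi>]) (auto simp: h_\<Psi>)

lemma h_nonpos:
  assumes t: "t \<in> {0..1}"
  shows "neg_semidefinite_on (L t) (h t)"
  unfolding neg_semidefinite_on_def L_def
proof (clarsimp simp: h_\<Psi>[OF t])
  fix x :: "real^'n"
  show "0 \<le> (\<Sum>k\<in>UNIV. c k * (x $ k)\<^sup>2)" by (intro sum_nonneg) (simp add: c_nonneg)
qed

lemma h_neg:
  assumes t: "t \<in> {0..1}" and c: "\<And>k. c k \<noteq> 0"
  shows "neg_definite_on (L t) (h t)"
  unfolding neg_definite_on_def L_def
proof (clarsimp simp: h_\<Psi>[OF t])
  fix x :: "real^'n" assume "blinfun_apply (\<Psi> t) x \<noteq> 0"
  then have "x \<noteq> 0" by (auto simp: blinfun.zero_right)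
  then obtain k where "x $ k \<noteq> 0" by (auto simp: vec_eq_iff)
  moreover have "0 < c k" for k using c[of k] c_nonneg[of k] by simp
  ultimately show "0 < (\<Sum>k\<in>UNIV. c k * (x $ k)\<^sup>2)"
    by (intro sum_pos2[of _ k]) (auto simp: less_imp_le)
qed

end

text \<open>A common vector is \<^const>\<open>omega\<close>-orthogonal to both subspaces, hence to everything.\<close>

lemma transverse_lagrangian_disjoint:
  assumes "lagrangian \<Lambda>0" "lagrangian \<Lambda>1" "transverse \<Lambda>0 \<Lambda>1" "v \<in> \<Lambda>0" "v \<in> \<Lambda>1"
  shows "v = 0"
proof -
  have om: "omega v x = 0" if "x \<in> \<Lambda>0 \<or> x \<in> \<Lambda>1" for x
    using assms that by (auto simp: lagrangian_def)
  obtain x y where xy: "\<i> *s v = x + y" "x \<in> \<Lambda>0" "y \<in> \<Lambda>1"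
    using assms(3) unfolding transverse_def by blast
  have "Im (herm v (\<i> *s v)) = 0"
    unfolding xy(1) herm_add_right using om xy by (simp add: Im_herm)
  then show ?thesis by (simp add: herm_simps herm_self)
qed

theorem theorem1p5:
  fixes \<Lambda>0 \<Lambda>1 :: "(complex^'n) set"
  assumes "\<Lambda>0 \<in> LG_plus" and "\<Lambda>1 \<in> LG_plus"
    and "maslov_index \<Lambda>0 \<Lambda>1 = 0"
  shows "\<exists>L h. LG_geodesic L \<and> L 0 = \<Lambda>0 \<and> L 1 = \<Lambda>1 \<and> has_LG_derivative L h
    \<and> (\<forall>t\<in>{0..1}. neg_semidefinite_on (L t) (h t))
    \<and> (transverse \<Lambda>0 \<Lambda>1 \<longrightarrow> (\<forall>t\<in>{0..1}. neg_definite_on (L t) (h t)))"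
proof -
  have lag: "lagrangian \<Lambda>0" "lagrangian \<Lambda>1" using assms(1,2) by (simp_all add: LG_plus_lagrangian)
  obtain u :: "'n \<Rightarrow> complex^'n" and \<beta> where u: "unitary_frame u" and \<Lambda>0: "range (frame_map u) = \<Lambda>0"
    and \<beta>: "\<And>j. \<beta> j \<in> {0..<pi}" and \<Lambda>1: "range (frame_map (\<lambda>j. cis (\<beta> j) *s u j)) = \<Lambda>1"
    and u1: "unitary_frame (\<lambda>j. cis (\<beta> j) *s u j)"
    by (rule lagrangian_pair_frame[OF lag]) (rule that)
  define \<theta>0 where "\<theta>0 = phase \<Lambda>0"
  have \<theta>0: "\<theta>0 \<in> {-pi/2<..<pi/2}" and ph: "\<exists>s\<in>{-1, 1}. Omega u = of_real s * cis \<theta>0"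
    using phase_unitary_frame[OF assms(1) u \<Lambda>0] by (simp_all add: \<theta>0_def)
  have "phase \<Lambda>1 \<in> {-pi/2<..<pi/2}" by (rule phase_unitary_frame(1)[OF assms(2) u1 \<Lambda>1])
  moreover have "phase \<Lambda>1 = \<theta>0 + (\<Sum>j\<in>UNIV. \<beta> j)"
    using maslov_index_frame[OF u \<beta> \<Lambda>0 \<Lambda>1] assms(3) by (simp add: \<theta>0_def)
  ultimately have \<theta>1: "\<theta>0 + (\<Sum>j\<in>UNIV. \<beta> j) < pi/2" by simp
  have \<beta>0: "0 \<le> \<beta> j" for j using \<beta>[of j] by simp
  have low: "-pi/2 < \<theta>0" using \<theta>0 by simp
  obtain c :: "'n \<Rightarrow> real" and b \<rho> where c: "\<And>k. 0 \<le> c k" "\<And>k. c k = 0 \<Longrightarrow> \<beta> k = 0"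
    and b: "\<And>k. b k 0 = 0" "\<And>k. b k 1 = \<beta> k"
    and ode: "\<And>t k. t \<in> {0..1} \<Longrightarrow> 0 < \<rho> k t"
      "\<And>t. t \<in> {0..1} \<Longrightarrow> \<theta>0 + (\<Sum>k\<in>UNIV. b k t) \<in> {-pi/2<..<pi/2}"
      "\<And>t k. t \<in> {0..1} \<Longrightarrow> (b k has_real_derivative c k / \<rho> k t) (at t within {0..1})"
      "\<And>t k. t \<in> {0..1} \<Longrightarrow>
         (\<rho> k has_real_derivative 2 * c k * tan (\<theta>0 + (\<Sum>k\<in>UNIV. b k t))) (at t within {0..1})"
    by (rule neck_ode_solution[OF \<beta>0 low \<theta>1]) (rule that)
  interpret neck u \<theta>0 c b \<rho>
    by unfold_locales (use u ph c(1) ode in auto)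
  have "L 0 = \<Lambda>0" using L_eq[of 0] \<Lambda>0 by (simp add: b)
  moreover have "L 1 = \<Lambda>1" using L_eq[of 1] \<Lambda>1 by (simp add: b)
  moreover have "c k \<noteq> 0" if tr: "transverse \<Lambda>0 \<Lambda>1" for k
  proof
    assume "c k = 0"
    then have "\<beta> k = 0" by (rule c(2))
    moreover have "cis (\<beta> k) *s u k \<in> \<Lambda>1"
      using frame_map_axis[of "\<lambda>j. cis (\<beta> j) *s u j" k] \<Lambda>1 by (metis rangeI)
    ultimately have "u k \<in> \<Lambda>1" by simp
    moreover have "u k \<in> \<Lambda>0" using frame_map_axis[of u k] \<Lambda>0 by (metis rangeI)
    ultimately have "u k = 0" using transverse_lagrangian_disjoint[OF lag tr] by blast
    then show False using unitary_frameD[OF u, of k k] by simp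
  qed
  ultimately show ?thesis
    using geodesic_L has_LG_derivative_h h_nonpos h_neg by blast
qed

end
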